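(* Let $\mathbf{P}$ be a fixed nonzero pattern matrix of rank $r$, $\mathbf{B}$ its $m\times n$ blown up matrix with positive singular values $s_1\ge\dots\ge s_r>0$, $\mathbf{W}$ an $m\times n$ Wigner-noise and $\mathbf{A}=\mathbf{B}+\mathbf{W}$. Let $\mathbf{v}_1,\dots,\mathbf{v}_r\in\mathbb{R}^m$ and $\mathbf{u}_1,\dots,\mathbf{u}_r\in\mathbb{R}^n$ be orthonormal left- and right-hand side singular vectors of $\mathbf{B}$ with $\mathbf{B}\mathbf{u}_i=s_i\mathbf{v}_i$, and put $F=\mathrm{Span}\{\mathbf{v}_1,\dots,\mathbf{v}_r\}$, $G=\mathrm{Span}\{\mathbf{u}_1,\dots,\mathbf{u}_r\}$. Let $\mathbf{y}_1,\dots,\mathbf{y}_r\in\mathbb{R}^m$ and $\mathbf{x}_1,\dots,\mathbf{x}_r\in\mathbb{R}^n$ be orthonormal left- and right-hand side singular vectors of $\mathbf{A}$ corresponding to its $r$ largest singular values $z_1,\dots,z_r$, with $\mathbf{A}\mathbf{x}_i=z_i\mathbf{y}_i$. Let $\varepsilon=\|\mathbf{W}\|$ and $\Delta=\min_{1\le i\le r}s_i$. Then, under the growth condition GC1, the following estimates hold almost surely: $$\sum_{i=1}^r\mathrm{dist}^2(\mathbf{y}_i,F)\le r\,\frac{\varepsilon^2}{(\Delta-\varepsilon)^2}=\mathcal{O}\left(\frac{m+n}{mn}\right)$$ and $$\sum_{i=1}^r\mathrm{dist}^2(\mathbf{x}_i,G)\le r\,\frac{\varepsilon^2}{(\Delt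a-\varepsilon)^2}=\mathcal{O}\left(\frac{m+n}{mn}\right).$$
   Context: $\mathrm{dist}$ is the Euclidean distance between a vector and a subspace; $\|\cdot\|$ of a matrix is the spectral norm. Wigner-noise: an $m\times n$ real random matrix $\mathbf{W}$ with independent entries $w_{ij}$, $\mathbb{E}(w_{ij})=0$, uniformly bounded: $|w_{ij}|\le K$ for all $i,j$, with a constant $K>0$ independent of $m$ and $n$. Blown up matrix: given an $a\times b$ pattern matrix $\mathbf{P}$ with entries $0\le p_{ij}\le1$ and positive integers $m_1,\dots,m_a$ with $\sum_i m_i=m$ and $n_1,\dots,n_b$ with $\sum_j n_j=n$, the blown up matrix $\mathbf{B}$ is the $m\times n$ matrix divided into $a\times b$ blocks, where block $(i,j)$ is an $m_i\times n_j$ matrix with all entries equal to $p_{ij}$. The pattern $\mathbf{P}$ (with $a,b$) is fixed, while $m,n$ and the block sizes vary. GC1: there are constants $0<c<1$ and $0<d<1$, independent of $m,n$, such that $m_i/m\ge c$ for $i=1,\dots,a$ and $n_j/n\ge d$ for $j=1,\dots,b$. Almost surely: a property $\mathcal{P}_{m,n}$ holds almost surely for the random matrices $\mathbf{A}_{m\times n}$ if $\mathbb{P}(\exists\, m_0,n_0\in\mathbb{N}$ such that for all $m\ge m_0$ and $n\ge n_0$, $\mathbf{A}_{m\times n}$ has $\mathcal{P}_{m,n})=1$, where $m,n$ and the block sizes grow subject to the stated growth condition and $K$ is kept fixed. A bound $\mathcal{O}(f(m,n))$ holds almost surely if there is a constant $C$ independent of $m,n$ such that the bound $\le C f(m,n)$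 holds almost surely in this sense. *)

theory Defs
  imports
    "HOL-Probability.Probability"
    "Jordan_Normal_Form.DL_Rank"
    "Jordan_Normal_Form.Char_Poly"
begin

definition vec_norm2 :: "real vec \<Rightarrow> real" where
  "vec_norm2 x = sqrt (scalar_prod x x)"

definition spectral_norm :: "real mat \<Rightarrow> real" where
  "spectral_norm A =
     Sup {vec_norm2 (A *\<^sub>v x) | x. x \<in> carrier_vec (dim_col A) \<and> vec_norm2 x \<le> 1}"

definition vec_span :: "nat \<Rightarrow> real vec set \<Rightarrow> real vec set" where
  "vec_span n S = LinearCombinations.module.span class_ring (module_vec TYPE(real) n) S"

definition dist_subspace :: "real vec \<Rightarrow> real vec set \<Rightarrow> real" where
  "dist_subspace x F = (INF f\<in>F. vec_norm2 (x - f))"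

definition orthonormal_family :: "nat \<Rightarrow> nat \<Rightarrow> (nat \<Rightarrow> real vec) \<Rightarrow> bool" where
  "orthonormal_family n r v \<longleftrightarrow>
     (\<forall>i<r. v i \<in> carrier_vec n) \<and>
     (\<forall>i<r. \<forall>j<r. scalar_prod (v i) (v j) = (if i = j then 1 else 0))"

text \<open>
  The singular values of an \<open>m \<times> n\<close> matrix \<open>A\<close>: the square roots of the \<open>min m n\<close> largest
  eigenvalues of \<open>A\<^sup>T A\<close>, counted with multiplicity and listed in non-increasing order.
  If \<open>n > m\<close>, the \<open>n - m\<close> entries that are cut off are zeros.
\<close>

definition singular_values :: "real mat \<Rightarrow> real list" where
  "singular_values A =
     take (min (dim_row A) (dim_col A))
       (rev (sorted_list_of_multiset
         (image_mset sqrt (proots (char_poly (transpose_mat A * A))))))"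

text \<open>
  Both equations are needed for \<open>v i\<close>, \<open>u i\<close> to be left and right singular vectors: together
  they say that \<open>A\<^sup>T A u = s\<^sup>2 u\<close> and \<open>A A\<^sup>T v = s\<^sup>2 v\<close>. Which singular values the \<open>s i\<close> are is not
  fixed here.
\<close>

definition singular_triples ::
  "real mat \<Rightarrow> nat \<Rightarrow> (nat \<Rightarrow> real) \<Rightarrow> (nat \<Rightarrow> real vec) \<Rightarrow> (nat \<Rightarrow> real vec) \<Rightarrow> bool" where
  "singular_triples A r s v u \<longleftrightarrow>
     orthonormal_family (dim_row A) r v \<and>
     orthonormal_family (dim_col A) r u \<and>
     (\<forall>i<r. A *\<^sub>v u i = s i \<cdot>\<^sub>v v i \<and> transpose_mat A *\<^sub>v v i = s i \<cdot>\<^sub>v u i)"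

definition pattern_matrix :: "nat \<Rightarrow> nat \<Rightarrow> real mat \<Rightarrow> bool" where
  "pattern_matrix a b P \<longleftrightarrow>
     P \<in> carrier_mat a b \<and> (\<forall>i<a. \<forall>j<b. 0 \<le> P $$ (i, j) \<and> P $$ (i, j) \<le> 1)"

definition block_sizes :: "nat \<Rightarrow> nat \<Rightarrow> nat list \<Rightarrow> bool" where
  "block_sizes a m ms \<longleftrightarrow> length ms = a \<and> (\<forall>k\<in>set ms. 0 < k) \<and> sum_list ms = m"

text \<open>
  The list \<open>block_labels ms\<close> has length \<open>sum_list ms\<close>; its entry at position \<open>i\<close> is the index
  of the block that contains row (or column) \<open>i\<close>.
\<close>

definition block_labels :: "nat list \<Rightarrow> nat list" where
  "block_labels ms = concat (map (\<lambda>k. replicate (ms ! k) k) [0..<length ms])"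

definition blown_up :: "real mat \<Rightarrow> nat list \<Rightarrow> nat list \<Rightarrow> real mat" where
  "blown_up P ms ns =
     mat (sum_list ms) (sum_list ns)
       (\<lambda>(i, j). P $$ (block_labels ms ! i, block_labels ns ! j))"

definition growth_condition_1 :: "real \<Rightarrow> real \<Rightarrow> nat list \<Rightarrow> nat list \<Rightarrow> bool" where
  "growth_condition_1 c d ms ns \<longleftrightarrow>
     (\<forall>k\<in>set ms. c \<le> real k / real (sum_list ms)) \<and>
     (\<forall>k\<in>set ns. d \<le> real k / real (sum_list ns))"

definition wigner_noise ::
  "'w measure \<Rightarrow> real \<Rightarrow> nat \<Rightarrow> nat \<Rightarrow> ('w \<Rightarrow> real mat) \<Rightarrow> bool" where
  "wigner_noise M K m n W \<longleftrightarrow>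
     (\<forall>\<omega>\<in>space M. W \<omega> \<in> carrier_mat m n) \<and>
     prob_space.indep_vars M (\<lambda>_. borel) (\<lambda>ij \<omega>. W \<omega> $$ ij) ({..<m} \<times> {..<n}) \<and>
     (\<forall>i<m. \<forall>j<n.
        prob_space.expectation M (\<lambda>\<omega>. W \<omega> $$ (i, j)) = 0 \<and>
        (AE \<omega> in M. \<bar>W \<omega> $$ (i, j)\<bar> \<le> K))"

text \<open>
  The threshold \<open>(m0, n0)\<close> may depend on the outcome \<open>\<omega>\<close>, and the matrices of all sizes live on
  one probability space, whose coupling of different sizes is arbitrary.
\<close>

definition holds_almost_surely ::
  "'w measure \<Rightarrow> (nat \<Rightarrow> nat \<Rightarrow> 'w \<Rightarrow> bool) \<Rightarrow> bool" where
  "holds_almost_surely M Q \<longleftrightarrow>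
     (AE \<omega> in M. \<exists>m0 n0. \<forall>m\<ge>m0. \<forall>n\<ge>n0. Q m n \<omega>)"

end

theory Submission
  imports Defs
begin

text \<open>
  From \<open>z y = A x = B x + W x\<close> and \<open>B x \<in> F\<close>, a left singular vector \<open>y\<close> of \<open>A\<close> has distance at most
  \<open>\<epsilon> / z\<close> from \<open>F\<close>, and \<open>z \<ge> \<Delta> - \<epsilon>\<close> by Weyl's inequality; the transposed identity handles \<open>G\<close>. That
  \<open>F\<close> is the whole column space of \<open>B\<close> is forced by the list of all positive singular values having
  length \<open>r\<close>.

  For the rate, \<open>\<Delta> \<ge> \<kappa> sqrt (m n)\<close> because singular vectors of \<open>B\<close> are blockwise constant, and
  \<open>\<epsilon> \<le> \<tau> sqrt (m + n)\<close> eventually: a bilinear form on two unit balls is maximised, up to scaling,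
  at points of integer lattices inside balls, of which there are at most \<open>48\<^sup>m\<close> and \<open>48\<^sup>n\<close>, so
  Hoeffding's inequality, a union bound and the Borel--Cantelli lemma along \<open>k = m + n\<close> apply.
\<close>

text \<open>\<open>singular_values\<close> is defined through the roots of a characteristic
  polynomial, so it says nothing about vectors until \<open>A\<^sup>T A\<close> has an orthonormal
  eigenbasis whose eigenvalues are exactly that multiset of roots. This is why the spectral theorem
  comes first.

  The quantifiers shape the rest: block sizes and singular vectors may depend on the outcome, with
  no measurability assumed. Hence chance is confined to one event about \<open>W\<close> alone, and
  all reasoning about singular vectors is deterministic, with constants that are fixed before the
  sizes.

  The lower bound on \<open>\<Delta>\<close> must be uniform over all admissible block proportions,
  although \<open>P\<close> may be rank deficient, so that no inverse of \<open>P\<close> is at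
  hand. The way out is linear algebra on the fixed rows of \<open>P\<close>: every vector in their
  span has coefficients bounded by a fixed multiple of its largest entry, with a factor depending on
  \<open>P\<close> only.\<close>

unbundle no inner_syntax
no_notation Finite_Cartesian_Product.vec_nth (infixl "$" 90)

section \<open>Orthogonal diagonalisation of real symmetric matrices\<close>

text \<open>The fundamental theorem of algebra gives a complex eigenvector with real part
  \<open>p\<close> and imaginary part \<open>q\<close>. Symmetry of \<open>A\<close>, tested on
  \<open>p\<close> and \<open>q\<close>, leaves
  \<open>Im z * (q \<bullet> q + p \<bullet> p) = 0\<close>, so the eigenvalue is real. Then
  \<open>p\<close> and \<open>q\<close> satisfy the eigenvector equation separately, and one of them
  is nonzero.\<close>

lemma symmetric_real_eigenvector:
  fixes A :: "real mat"
  assumes A: "A \<in> carrier_mat n n" and sym: "transpose_mat A = A" and n: "n > 0"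
  shows "\<exists>v l. v \<in> carrier_vec n \<and> v \<bullet> v = 1 \<and> A *\<^sub>v v = l \<cdot>\<^sub>v v"
proof -
  define C where "C = map_mat complex_of_real A"
  have C: "C \<in> carrier_mat n n" using A by (auto simp: C_def)
  have "\<not> constant (poly (char_poly C))"
    using degree_monic_char_poly[OF C] n by (simp add: constant_degree)
  then obtain z where "poly (char_poly C) z = 0"
    using fundamental_theorem_of_algebra by blast
  then have "eigenvalue C z" using eigenvalue_root_char_poly[OF C] by simp
  then obtain w where w: "w \<in> carrier_vec n" "w \<noteq> 0\<^sub>v n" "C *\<^sub>v w = z \<cdot>\<^sub>v w"
    using C unfolding eigenvalue_def eigenvector_def by auto
  define p where "p = map_vec Re w"
  define q where "q = map_vec Im w"
  have p: "p \<in> carrier_vec n" and q: "q \<in> carrier_vec n" using w by (auto simp: p_def q_def)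
  have comp: "(\<Sum>j<n. A $$ (i,j) * p $ j) = Re z * p $ i - Im z * q $ i"
       "(\<Sum>j<n. A $$ (i,j) * q $ j) = Re z * q $ i + Im z * p $ i" if i: "i < n" for i
  proof -
    have *: "(\<Sum>j<n. complex_of_real (A $$ (i,j)) * w $ j) = z * w $ i"
      using arg_cong[OF w(3), of "\<lambda>x. x $ i"] i C w(1) A
      by (simp add: C_def scalar_prod_def lessThan_atLeast0)
    show "(\<Sum>j<n. A $$ (i,j) * p $ j) = Re z * p $ i - Im z * q $ i"
      using arg_cong[OF *, of Re] i w(1) by (simp add: p_def q_def)
    show "(\<Sum>j<n. A $$ (i,j) * q $ j) = Re z * q $ i + Im z * p $ i"
      using arg_cong[OF *, of Im] i w(1) by (simp add: p_def q_def)
  qed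
  have Ap: "A *\<^sub>v p = Re z \<cdot>\<^sub>v p - Im z \<cdot>\<^sub>v q" and Aq: "A *\<^sub>v q = Re z \<cdot>\<^sub>v q + Im z \<cdot>\<^sub>v p"
    using comp A p q by (auto intro!: eq_vecI simp: scalar_prod_def lessThan_atLeast0)
  have "q \<bullet> (A *\<^sub>v p) = (A *\<^sub>v q) \<bullet> p"
    using A p q transpose_vec_mult_scalar[OF A p q] sym by simp
  then have "Im z * (q \<bullet> q + p \<bullet> p) = 0"
    unfolding Ap Aq using p q
    by (simp add: scalar_prod_minus_distrib add_scalar_prod_distrib comm_scalar_prod[OF p q] algebra_simps)
  moreover have "q \<bullet> q + p \<bullet> p \<noteq> 0"
  proof
    assume "q \<bullet> q + p \<bullet> p = 0"
    then have "(\<Sum>i<n. (q $ i)\<^sup>2 + (p $ i)\<^sup>2) = 0"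
      using p q by (simp add: scalar_prod_def lessThan_atLeast0 power2_eq_square sum.distrib)
    then have "\<forall>i<n. (q $ i)\<^sup>2 + (p $ i)\<^sup>2 = 0" by (subst (asm) sum_nonneg_eq_0_iff) auto
    then have "w = 0\<^sub>v n" using w(1)
      by (auto intro!: eq_vecI complex_eqI simp: p_def q_def sum_power2_eq_zero_iff)
    with w(2) show False by simp
  qed
  ultimately have "Im z = 0" by simp
  then have ev: "A *\<^sub>v p = Re z \<cdot>\<^sub>v p" "A *\<^sub>v q = Re z \<cdot>\<^sub>v q" using Ap Aq p q by auto
  have main: ?thesis if x: "x \<in> carrier_vec n" "A *\<^sub>v x = l \<cdot>\<^sub>v x" "x \<bullet> x > 0" for x l
  proof (intro exI conjI)
    show "(1 / sqrt (x \<bullet> x)) \<cdot>\<^sub>v x \<in> carrier_vec n" using x by auto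
    show "((1 / sqrt (x \<bullet> x)) \<cdot>\<^sub>v x) \<bullet> ((1 / sqrt (x \<bullet> x)) \<cdot>\<^sub>v x) = 1" using x by auto
    show "A *\<^sub>v ((1 / sqrt (x \<bullet> x)) \<cdot>\<^sub>v x) = l \<cdot>\<^sub>v ((1 / sqrt (x \<bullet> x)) \<cdot>\<^sub>v x)"
      using x A by (simp add: mult_mat_vec smult_smult_assoc mult.commute)
  qed
  have nn: "q \<bullet> q \<ge> 0" "p \<bullet> p \<ge> 0" by (auto simp: scalar_prod_def intro: sum_nonneg)
  then have "q \<bullet> q > 0 \<or> p \<bullet> p > 0" using \<open>q \<bullet> q + p \<bullet> p \<noteq> 0\<close> by linarith
  then show ?thesis using main ev p q by blast
qed

text \<open>The witness is the reflection in the hyperplane orthogonal to \<open>v - e\<close>,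
  where \<open>e\<close> is the first unit vector. Being symmetric and its own inverse, it can be
  used for conjugation without losing symmetry. For \<open>v = e\<close> the normal vector vanishes,
  hence the separate case.\<close>

lemma householder_reflection:
  fixes v :: "real vec"
  assumes v: "v \<in> carrier_vec n" "v \<bullet> v = 1" and n: "n > 0"
  shows "\<exists>H \<in> carrier_mat n n. transpose_mat H = H \<and> H * H = 1\<^sub>m n \<and> H *\<^sub>v unit_vec n 0 = v"
proof (cases "v = unit_vec n 0")
  case True
  then show ?thesis using v by (intro bexI[of _ "1\<^sub>m n"]) auto
next
  case False
  define e where "e = (unit_vec n 0 :: real vec)"
  define w where "w = v - e"
  have e: "e \<in> carrier_vec n" and w: "w \<in> carrier_vec n" using v by (auto simp: e_def w_def)
  define t where "t = w \<bullet> w"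
  have ve: "v \<bullet> e = v $ 0" "e \<bullet> v = v $ 0" and ee: "e \<bullet> e = 1" using v n by (auto simp: e_def)
  have t: "t = 2 - 2 * v $ 0"
    unfolding t_def w_def using v e ve ee
    by (simp add: scalar_prod_minus_distrib minus_scalar_prod_distrib)
  have we: "w \<bullet> e = v $ 0 - 1" unfolding w_def using v e ve ee
    by (simp add: minus_scalar_prod_distrib)
  have "t \<noteq> 0"
  proof
    assume "t = 0"
    then have "(\<Sum>i<n. (w $ i)\<^sup>2) = 0"
      using w by (simp add: t_def scalar_prod_def lessThan_atLeast0 power2_eq_square)
    then have *: "\<forall>i<n. (w $ i)\<^sup>2 = 0" by (subst (asm) sum_nonneg_eq_0_iff) auto
    have "v = e"
    proof (rule eq_vecI)
      fix i assume "i < dim_vec e"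
      then show "v $ i = e $ i" using * v e by (auto simp: w_def)
    qed (use v e in auto)
    with False show False by (simp add: e_def)
  qed
  define H where "H = Matrix.mat n n (\<lambda>(i,j). (if i = j then 1 else 0) - 2 / t * (w $ i * w $ j))"
  have H: "H \<in> carrier_mat n n" by (simp add: H_def)
  have Hx: "H *\<^sub>v x = x - (2 / t * (w \<bullet> x)) \<cdot>\<^sub>v w" if x: "x \<in> carrier_vec n" for x
  proof (rule eq_vecI)
    fix i assume "i < dim_vec (x - (2 / t * (w \<bullet> x)) \<cdot>\<^sub>v w)"
    then have i: "i < n" using w by auto
    have "(H *\<^sub>v x) $ i = (\<Sum>j<n. ((if i = j then 1 else 0) - 2 / t * (w $ i * w $ j)) * x $ j)"
      using i x by (simp add: H_def scalar_prod_def lessThan_atLeast0)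
    also have "\<dots> = (\<Sum>j<n. (if i = j then x $ j else 0)) - 2 / t * (w $ i * (\<Sum>j<n. w $ j * x $ j))"
      unfolding sum_distrib_left sum_subtractf[symmetric] by (rule sum.cong) (auto simp: algebra_simps)
    also have "\<dots> = (x - (2 / t * (w \<bullet> x)) \<cdot>\<^sub>v w) $ i"
      using i x w by (simp add: scalar_prod_def lessThan_atLeast0)
    finally show "(H *\<^sub>v x) $ i = (x - (2 / t * (w \<bullet> x)) \<cdot>\<^sub>v w) $ i" .
  qed (use H w in auto)
  have "transpose_mat H = H" by (rule eq_matI) (auto simp: H_def)
  moreover have "H * H = 1\<^sub>m n"
  proof (rule eq_matI)
    fix i j assume "i < dim_row (1\<^sub>m n :: real mat)" "j < dim_col (1\<^sub>m n :: real mat)"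
    then have ij: "i < n" "j < n" by auto
    have u: "unit_vec n j \<in> carrier_vec n" by simp
    define c where "c = 2 / t * (w \<bullet> unit_vec n j)"
    have Hu: "H *\<^sub>v unit_vec n j = unit_vec n j - c \<cdot>\<^sub>v w" unfolding c_def by (rule Hx[OF u])
    have "w \<bullet> (unit_vec n j - c \<cdot>\<^sub>v w) = w \<bullet> unit_vec n j - c * t"
      using w by (subst scalar_prod_minus_distrib[of _ n]) (auto simp: t_def)
    then have cc: "2 / t * (w \<bullet> (unit_vec n j - c \<cdot>\<^sub>v w)) = - c"
      using \<open>t \<noteq> 0\<close> by (simp add: c_def field_simps)
    have "H *\<^sub>v (H *\<^sub>v unit_vec n j) = (unit_vec n j - c \<cdot>\<^sub>v w) - (- c) \<cdot>\<^sub>v w"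
      unfolding Hu using w by (subst Hx) (auto simp: cc simp del: times_divide_eq_left)
    also have "\<dots> = unit_vec n j" using w by (intro eq_vecI) auto
    finally have "H *\<^sub>v (H *\<^sub>v unit_vec n j) = unit_vec n j" .
    then have "(H * H) *\<^sub>v unit_vec n j = unit_vec n j" using H by (simp add: assoc_mult_mat_vec[of _ n n _ n])
    then have "((H * H) *\<^sub>v unit_vec n j) $ i = unit_vec n j $ i" by simp
    moreover have "(X *\<^sub>v unit_vec n j) $ i = X $$ (i, j)" if "X \<in> carrier_mat n n" for X :: "real mat"
      using that ij by auto
    from this[of "H * H"] have "((H * H) *\<^sub>v unit_vec n j) $ i = (H * H) $$ (i, j)" using H by simp
    ultimately show "(H * H) $$ (i, j) = 1\<^sub>m n $$ (i, j)"
      using ij by (auto simp: unit_vec_def)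
  qed (use H in auto)
  moreover have "H *\<^sub>v e = v"
  proof -
    \<comment> \<open>\<open>w \<bullet> e = v $ 0 - 1 = - t / 2\<close>, because \<open>v\<close>
      and \<open>e\<close> both have unit length.\<close>
    have "2 / t * (w \<bullet> e) = -1" using \<open>t \<noteq> 0\<close> by (simp add: we t field_simps)
    then have "H *\<^sub>v e = e - (-1) \<cdot>\<^sub>v w" using Hx[OF e] by simp
    also have "\<dots> = v" using v e by (intro eq_vecI) (auto simp: w_def)
    finally show ?thesis .
  qed
  ultimately show ?thesis using H by (auto simp: e_def)
qed

text \<open>Deflation: the reflection carries a unit eigenvector to the first axis, so the
  conjugated matrix has a multiple of the unit vector as first column; symmetry clears the first
  row, and the induction hypothesis takes the remaining block. Using \<open>transpose_mat U\<close>
  as the inverse in the similarity witness expresses that \<open>U\<close> is orthogonal.\<close>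

theorem symmetric_orthogonally_diagonalizable:
  fixes A :: "real mat"
  assumes "A \<in> carrier_mat n n" and "transpose_mat A = A"
  shows "\<exists>U f. similar_mat_wit A (mat_diag n f) U (transpose_mat U)"
  using assms
proof (induction n arbitrary: A)
  case 0
  then show ?case
    by (intro exI[of _ "1\<^sub>m 0"] exI[of _ "\<lambda>_. 0"] similar_mat_witI[of _ _ 0]) (auto simp: mat_diag_def)
next
  case (Suc n)
  note A = Suc.prems(1) and sym = Suc.prems(2)
  obtain v l where v: "v \<in> carrier_vec (Suc n)" "v \<bullet> v = 1" and Av: "A *\<^sub>v v = l \<cdot>\<^sub>v v"
    using symmetric_real_eigenvector[OF A sym] by auto
  obtain H where H: "H \<in> carrier_mat (Suc n) (Suc n)" and HT: "transpose_mat H = H"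
    and HH: "H * H = 1\<^sub>m (Suc n)" and He: "H *\<^sub>v unit_vec (Suc n) 0 = v"
    using householder_reflection[OF v] by auto
  define A' where "A' = H * A * H"
  have A': "A' \<in> carrier_mat (Suc n) (Suc n)" using H A by (simp add: A'_def)
  have symA': "transpose_mat A' = A'"
  proof -
    have HA: "H * A \<in> carrier_mat (Suc n) (Suc n)" using A H by simp
    show ?thesis unfolding A'_def transpose_mult[OF HA H] transpose_mult[OF H A] sym HT
      using A H by (simp add: assoc_mult_mat[of _ "Suc n" "Suc n" _ "Suc n" _ "Suc n"])
  qed
  have "H *\<^sub>v v = (H * H) *\<^sub>v unit_vec (Suc n) 0"
    using H by (simp add: He[symmetric] assoc_mult_mat_vec[of _ "Suc n" "Suc n" _ "Suc n"])
  then have Hv: "H *\<^sub>v v = unit_vec (Suc n) 0" by (simp add: HH)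
  have "A' *\<^sub>v unit_vec (Suc n) 0 = H *\<^sub>v (A *\<^sub>v (H *\<^sub>v unit_vec (Suc n) 0))"
    using A H unfolding A'_def by (simp add: assoc_mult_mat_vec[of _ "Suc n" "Suc n" _ "Suc n"])
  also have "\<dots> = l \<cdot>\<^sub>v unit_vec (Suc n) 0" using H v by (simp add: He Av mult_mat_vec Hv)
  finally have ev: "A' *\<^sub>v unit_vec (Suc n) 0 = l \<cdot>\<^sub>v unit_vec (Suc n) 0" .
  have col0: "A' $$ (i, 0) = (if i = 0 then l else 0)" if "i < Suc n" for i
  proof -
    have "(A' *\<^sub>v unit_vec (Suc n) 0) $ i = A' $$ (i, 0)" using that A' by auto
    then show ?thesis using that unfolding ev by (cases "i = 0") auto
  qed
  have row0: "A' $$ (0, i) = (if i = 0 then l else 0)" if "i < Suc n" for i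
    using arg_cong[OF symA', of "\<lambda>X. X $$ (i, 0)"] that A' col0[OF that] by auto
  define A3 where "A3 = Matrix.mat n n (\<lambda>(i,j). A' $$ (Suc i, Suc j))"
  have A3: "A3 \<in> carrier_mat n n" by (simp add: A3_def)
  have "transpose_mat A3 = A3"
  proof (rule eq_matI)
    fix i j assume "i < dim_row A3" "j < dim_col A3"
    then show "transpose_mat A3 $$ (i,j) = A3 $$ (i,j)"
      using arg_cong[OF symA', of "\<lambda>X. X $$ (Suc i, Suc j)"] A' by (simp add: A3_def)
  qed (auto simp: A3_def)
  from Suc.IH[OF A3 this] obtain U f where U: "similar_mat_wit A3 (mat_diag n f) U (transpose_mat U)"
    by blast
  have Uc: "U \<in> carrier_mat n n" using similar_mat_witD2[OF A3 U] by simp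
  define D1 where "D1 = mat_diag 1 (\<lambda>_::nat. l)"
  have D1: "D1 \<in> carrier_mat 1 1" by (simp add: D1_def)
  define g where "g i = (if i = 0 then l else f (i - 1))" for i
  let ?V = "four_block_mat (1\<^sub>m 1) (0\<^sub>m 1 n) (0\<^sub>m n 1) U"
  have "A' = four_block_mat D1 (0\<^sub>m 1 n) (0\<^sub>m n 1) A3"
    using A' A3 D1 col0 row0
    by (intro eq_matI) (auto simp: D1_def A3_def mat_diag_def)
  moreover have "mat_diag (Suc n) g = four_block_mat D1 (0\<^sub>m 1 n) (0\<^sub>m n 1) (mat_diag n f)"
    by (intro eq_matI) (auto simp: D1_def g_def mat_diag_def)
  moreover have "transpose_mat ?V = four_block_mat (1\<^sub>m 1) (0\<^sub>m 1 n) (0\<^sub>m n 1) (transpose_mat U)"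
    using Uc by (subst transpose_four_block_mat[of _ 1 1 _ n _ n]) auto
  moreover have "similar_mat_wit (four_block_mat D1 (0\<^sub>m 1 n) (0\<^sub>m n 1) A3)
     (four_block_mat D1 (0\<^sub>m 1 n) (0\<^sub>m n 1) (mat_diag n f)) ?V
     (four_block_mat (1\<^sub>m 1) (0\<^sub>m 1 n) (0\<^sub>m n 1) (transpose_mat U))"
    by (rule similar_mat_wit_four_block[OF similar_mat_wit_refl[OF D1] U _ _ D1 A3])
       (use Uc in auto)
  ultimately have V: "similar_mat_wit A' (mat_diag (Suc n) g) ?V (transpose_mat ?V)" by simp
  have "H * A' * H = (H * H) * A * (H * H)"
    using A H by (simp add: A'_def assoc_mult_mat[of _ "Suc n" "Suc n" _ "Suc n" _ "Suc n"])
  then have "A = H * A' * H" using A by (simp add: HH)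
  then have "similar_mat_wit A A' H H"
    using A A' H HH by (intro similar_mat_witI[of _ _ "Suc n"]) auto
  from similar_mat_wit_trans[OF this V]
  have "similar_mat_wit A (mat_diag (Suc n) g) (H * ?V) (transpose_mat (H * ?V))"
    using H Uc HT by (subst transpose_mult[of _ "Suc n" "Suc n"]) auto
  then show ?case by blast
qed

section \<open>Orthonormal families\<close>

lemma scalar_prod_self: "x \<in> carrier_vec n \<Longrightarrow> x \<bullet> x = (\<Sum>i<n. ((x :: real vec) $ i)\<^sup>2)"
  by (simp add: scalar_prod_def lessThan_atLeast0 power2_eq_square)

lemma scalar_prod_self_nonneg: "0 \<le> (x :: real vec) \<bullet> x"
  by (simp add: scalar_prod_def sum_nonneg)

lemma scalar_prod_self_eq_0: "x \<in> carrier_vec n \<Longrightarrow> (x :: real vec) \<bullet> x = 0 \<longleftrightarrow> x = 0\<^sub>v n"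
  by (auto simp: scalar_prod_self sum_nonneg_eq_0_iff)

lemma vec_norm2_power2: "(vec_norm2 x)\<^sup>2 = x \<bullet> x"
  by (simp add: vec_norm2_def scalar_prod_self_nonneg)

lemma vec_norm2_nonneg: "0 \<le> vec_norm2 x"
  by (simp add: vec_norm2_def scalar_prod_self_nonneg)

lemma vec_norm2_L2: "x \<in> carrier_vec n \<Longrightarrow> vec_norm2 x = L2_set (($) x) {..<n}"
  by (simp add: vec_norm2_def L2_set_def scalar_prod_self)

lemma vec_norm2_smult: "vec_norm2 (a \<cdot>\<^sub>v x) = \<bar>a\<bar> * vec_norm2 x"
proof -
  have "(a \<cdot>\<^sub>v x) \<bullet> (a \<cdot>\<^sub>v x) = a\<^sup>2 * (x \<bullet> x)"
    by (simp add: power2_eq_square scalar_prod_smult_left[of _ x] scalar_prod_smult_right[of _ _ a])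
  then show ?thesis by (simp add: vec_norm2_def real_sqrt_mult)
qed

lemma vec_norm2_triangle:
  assumes "x \<in> carrier_vec n" "y \<in> carrier_vec n"
  shows "vec_norm2 (x + y) \<le> vec_norm2 x + vec_norm2 y"
proof -
  have "L2_set (($) (x + y)) {..<n} = L2_set (\<lambda>i. x $ i + y $ i) {..<n}"
    using assms by (intro L2_set_cong) auto
  then show ?thesis using assms L2_set_triangle_ineq[of "($) x" "($) y" "{..<n}"]
    by (simp add: vec_norm2_L2[of _ n])
qed

lemma scalar_prod_le_vec_norm2:
  assumes "x \<in> carrier_vec n" "y \<in> carrier_vec n"
  shows "x \<bullet> y \<le> vec_norm2 x * vec_norm2 y"
proof -
  have "x \<bullet> y \<le> (\<Sum>i<n. \<bar>x $ i\<bar> * \<bar>y $ i\<bar>)"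
    using assms by (auto simp: scalar_prod_def lessThan_atLeast0 abs_mult[symmetric] intro!: sum_mono)
  also have "\<dots> \<le> vec_norm2 x * vec_norm2 y"
    using L2_set_mult_ineq[of "($) x" "($) y" "{..<n}"] assms by (simp add: vec_norm2_L2[of _ n])
  finally show ?thesis .
qed

text \<open>Turns statements about families into matrix algebra: this matrix sends coefficients to
  linear combinations, and its transpose sends a vector to its inner products with the
  family.\<close>

definition family_mat :: "nat \<Rightarrow> nat \<Rightarrow> (nat \<Rightarrow> real vec) \<Rightarrow> real mat" where
  "family_mat n r u = Matrix.mat n r (\<lambda>(i, j). u j $ i)"

lemma family_mat_carrier [simp]: "family_mat n r u \<in> carrier_mat n r"
  by (simp add: family_mat_def)

lemma family_mat_dim [simp]: "dim_row (family_mat n r u) = n" "dim_col (family_mat n r u) = r"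
  by (simp_all add: family_mat_def)

lemma family_mat_mult_carrier [simp]:
  "family_mat n r u *\<^sub>v q \<in> carrier_vec n" "transpose_mat (family_mat n r u) *\<^sub>v x \<in> carrier_vec r"
  by (rule carrier_vecI, simp)+

lemma family_mat_mult_vec_index:
  "q \<in> carrier_vec r \<Longrightarrow> i < n \<Longrightarrow> (family_mat n r u *\<^sub>v q) $ i = (\<Sum>k<r. q $ k * u k $ i)"
  by (auto simp: family_mat_def scalar_prod_def lessThan_atLeast0 intro!: sum.cong)

lemma family_mat_transpose_mult_vec_index:
  assumes "orthonormal_family n r u" "x \<in> carrier_vec n" "i < r"
  shows "(transpose_mat (family_mat n r u) *\<^sub>v x) $ i = u i \<bullet> x"
  using assms by (simp add: family_mat_def scalar_prod_def)

lemma family_mat_orthonormal: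
  assumes "orthonormal_family n r u"
  shows "transpose_mat (family_mat n r u) * family_mat n r u = 1\<^sub>m r"
proof (rule eq_matI)
  fix i j assume ij: "i < dim_row (1\<^sub>m r :: real mat)" "j < dim_col (1\<^sub>m r :: real mat)"
  then have "u i \<bullet> u j = (if i = j then 1 else 0)" "u i \<in> carrier_vec n" "u j \<in> carrier_vec n"
    using assms by (auto simp: orthonormal_family_def)
  then show "(transpose_mat (family_mat n r u) * family_mat n r u) $$ (i, j) = 1\<^sub>m r $$ (i, j)"
    using ij by (simp add: family_mat_def scalar_prod_def)
qed auto

lemma family_mat_isometry:
  assumes u: "orthonormal_family n r u" and q: "q \<in> carrier_vec r" and p: "p \<in> carrier_vec r"
  shows "(family_mat n r u *\<^sub>v q) \<bullet> (family_mat n r u *\<^sub>v p) = q \<bullet> p"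
proof -
  let ?U = "family_mat n r u"
  have "(?U *\<^sub>v q) \<bullet> (?U *\<^sub>v p) = q \<bullet> (transpose_mat ?U *\<^sub>v (?U *\<^sub>v p))"
    using p q transpose_vec_mult_scalar[of ?U n r q "?U *\<^sub>v p"]
    by (simp add: comm_scalar_prod[of _ n "?U *\<^sub>v p"] comm_scalar_prod[of _ r q])
  also have "transpose_mat ?U *\<^sub>v (?U *\<^sub>v p) = p"
    using p family_mat_orthonormal[OF u] by (subst assoc_mult_mat_vec[of _ r n _ r, symmetric]) auto
  finally show ?thesis .
qed

text \<open>\<open>p\<close> is the orthogonal projection of \<open>x\<close>: both
  \<open>p \<bullet> p\<close> and \<open>x \<bullet> p\<close> equal the squared length of the
  coefficient vector. Bessel's inequality, its equality case and Parseval's identity all rest on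
  this.\<close>

lemma bessel_residual:
  assumes u: "orthonormal_family n r u" and x: "x \<in> carrier_vec n"
  defines "p \<equiv> family_mat n r u *\<^sub>v (transpose_mat (family_mat n r u) *\<^sub>v x)"
  shows "(x - p) \<bullet> (x - p) = x \<bullet> x - (\<Sum>i<r. (u i \<bullet> x)\<^sup>2)"
proof -
  let ?U = "family_mat n r u"
  let ?q = "transpose_mat ?U *\<^sub>v x"
  have q: "?q \<in> carrier_vec r" and p: "p \<in> carrier_vec n" by (auto simp: p_def)
  have qq: "?q \<bullet> ?q = (\<Sum>i<r. (u i \<bullet> x)\<^sup>2)"
    unfolding scalar_prod_self[OF q] using family_mat_transpose_mult_vec_index[OF u x]
    by (intro sum.cong refl) (simp only: lessThan_iff)
  have "p \<bullet> p = ?q \<bullet> ?q" unfolding p_def by (rule family_mat_isometry[OF u q q])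
  moreover have "x \<bullet> p = ?q \<bullet> ?q" unfolding p_def
    using x q by (subst transpose_vec_mult_scalar[of _ n r, symmetric]) auto
  ultimately show ?thesis
    using x p comm_scalar_prod[OF x p]
    by (simp add: scalar_prod_minus_distrib[of _ n] minus_scalar_prod_distrib[of _ n] qq)
qed

lemma bessel_inequality:
  assumes "orthonormal_family n r u" "x \<in> carrier_vec n"
  shows "(\<Sum>i<r. (u i \<bullet> x)\<^sup>2) \<le> x \<bullet> x"
  using bessel_residual[OF assms] scalar_prod_self_nonneg by (metis diff_ge_0_iff_ge)

lemma bessel_equality:
  assumes u: "orthonormal_family n r u" and x: "x \<in> carrier_vec n" and "(\<Sum>i<r. (u i \<bullet> x)\<^sup>2) = x \<bullet> x"
  shows "family_mat n r u *\<^sub>v (transpose_mat (family_mat n r u) *\<^sub>v x) = x"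
proof -
  let ?p = "family_mat n r u *\<^sub>v (transpose_mat (family_mat n r u) *\<^sub>v x)"
  have p: "?p \<in> carrier_vec n" by auto
  have "x - ?p = 0\<^sub>v n"
    using bessel_residual[OF u x] assms(3) scalar_prod_self_eq_0[of "x - ?p" n] x p by auto
  then have "x $ i - ?p $ i = 0" if "i < n" for i
    using that x p by (metis index_minus_vec(1) index_zero_vec(1) carrier_vecD)
  then show ?thesis using x p by (intro eq_vecI) auto
qed

text \<open>For a square matrix a left inverse is also a right inverse.\<close>

lemma orthonormal_basis_expansion:
  assumes u: "orthonormal_family n n u" and x: "x \<in> carrier_vec n"
  shows "family_mat n n u *\<^sub>v (transpose_mat (family_mat n n u) *\<^sub>v x) = x"
proof -
  let ?U = "family_mat n n u"
  have "?U * transpose_mat ?U = 1\<^sub>m n"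
    using mat_mult_left_right_inverse[OF _ _ family_mat_orthonormal[OF u]] by simp
  then show ?thesis using x by (subst assoc_mult_mat_vec[of _ n n _ n, symmetric]) auto
qed

lemma parseval:
  assumes u: "orthonormal_family n n u" and x: "x \<in> carrier_vec n"
  shows "(\<Sum>i<n. (u i \<bullet> x)\<^sup>2) = x \<bullet> x"
proof -
  have "(x - x) \<bullet> (x - x) = 0" using x by simp
  then show ?thesis using bessel_residual[OF u x] orthonormal_basis_expansion[OF u x] by simp
qed

text \<open>The same \<open>f\<close> has to give the eigenvalues, the quadratic form and the roots
  with multiplicity. The last holds because similar matrices share their characteristic polynomial,
  and that of a diagonal matrix is a product of linear factors.\<close>

lemma spectral_basis:
  fixes A :: "real mat"
  assumes A: "A \<in> carrier_mat n n" and sym: "transpose_mat A = A"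
  shows "\<exists>e f. orthonormal_family n n e \<and> (\<forall>j<n. A *\<^sub>v e j = f j \<cdot>\<^sub>v e j) \<and>
    (\<forall>x \<in> carrier_vec n. x \<bullet> (A *\<^sub>v x) = (\<Sum>j<n. f j * (e j \<bullet> x)\<^sup>2)) \<and>
    proots (char_poly A) = mset (map f [0..<n])"
proof -
  obtain U f where w: "similar_mat_wit A (mat_diag n f) U (transpose_mat U)"
    using symmetric_orthogonally_diagonalizable[OF A sym] by blast
  note U = similar_mat_witD2[OF A w]
  have Uc: "U \<in> carrier_mat n n" using U by simp
  define e where "e j = col U j" for j
  have Ue: "U = family_mat n n e" using Uc by (intro eq_matI) (auto simp: family_mat_def e_def)
  have e: "orthonormal_family n n e" unfolding orthonormal_family_def
  proof (intro conjI allI impI)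
    fix i j assume "i < n" "j < n"
    then show "e i \<bullet> e j = (if i = j then 1 else 0)"
      using arg_cong[OF U(2), of "\<lambda>X. X $$ (i,j)"] Uc by (simp add: e_def)
  qed (use Uc in \<open>auto simp: e_def\<close>)
  have AU: "A * U = U * mat_diag n f"
  proof -
    have "A * U = U * mat_diag n f * transpose_mat U * U" using U(3) by simp
    also have "\<dots> = U * mat_diag n f * (transpose_mat U * U)"
      using Uc by (intro assoc_mult_mat[of _ n n _ n _ n]) (auto simp: mat_diag_def)
    also have "\<dots> = U * mat_diag n f" using Uc U(2) by (simp add: mat_diag_def)
    finally show ?thesis .
  qed
  have ev: "A *\<^sub>v e j = f j \<cdot>\<^sub>v e j" if j: "j < n" for j
  proof -
    have "A *\<^sub>v e j = col (A * U) j" unfolding e_def by (rule col_mult2[OF A Uc j, symmetric])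
    also have "\<dots> = f j \<cdot>\<^sub>v e j"
      unfolding AU using j Uc by (intro eq_vecI) (auto simp: mat_diag_mult_right[of _ n n] e_def)
    finally show ?thesis .
  qed
  have quad: "x \<bullet> (A *\<^sub>v x) = (\<Sum>j<n. f j * (e j \<bullet> x)\<^sup>2)" if x: "x \<in> carrier_vec n" for x
  proof -
    define q where "q = transpose_mat U *\<^sub>v x"
    have q: "q \<in> carrier_vec n" using Uc x by (auto simp: q_def)
    have "A *\<^sub>v x = U *\<^sub>v (mat_diag n f *\<^sub>v q)"
      using Uc x by (subst U(3)) (simp add: q_def assoc_mult_mat_vec[of _ n n _ n] mat_diag_def)
    then have "x \<bullet> (A *\<^sub>v x) = q \<bullet> (mat_diag n f *\<^sub>v q)"
      using transpose_vec_mult_scalar[OF Uc _ x, of "mat_diag n f *\<^sub>v q"] q mat_diag_dim[of n f]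
      by (simp add: q_def[symmetric] del: mat_diag_dim)
    also have "\<dots> = (\<Sum>j<n. f j * (q $ j)\<^sup>2)"
    proof -
      have "(mat_diag n f *\<^sub>v q) $ j = f j * q $ j" if "j < n" for j
        using that q
        by (simp add: mat_diag_def scalar_prod_def lessThan_atLeast0 if_distrib[of "\<lambda>x. x * _"] cong: if_cong)
      then show ?thesis using q
        by (simp add: scalar_prod_def lessThan_atLeast0 power2_eq_square mat_diag_def mult_ac cong: sum.cong_simp)
    qed
    also have "\<dots> = (\<Sum>j<n. f j * (e j \<bullet> x)\<^sup>2)"
      using family_mat_transpose_mult_vec_index[OF e x] by (simp add: q_def Ue)
    finally show ?thesis .
  qed
  have "char_poly A = char_poly (mat_diag n f)"
    using w by (intro char_poly_similar) (auto simp: similar_mat_def)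
  also have "\<dots> = (\<Prod>a\<leftarrow>diag_mat (mat_diag n f). [:- a, 1:])"
    by (rule char_poly_upper_triangular[of _ n]) (auto simp: mat_diag_def)
  also have "diag_mat (mat_diag n f) = map f [0..<n]"
    by (auto simp: diag_mat_def mat_diag_def)
  finally have "char_poly A = (\<Prod>a\<leftarrow>map f [0..<n]. [:- a, 1:])" .
  moreover have "proots (\<Prod>a\<leftarrow>as. [:- a, 1 :: real:]) = mset as" for as
  proof (induction as)
    case (Cons a as)
    have "(\<Prod>a\<leftarrow>as. [:- a, 1 :: real:]) \<noteq> 0" by (auto simp: prod_list_zero_iff)
    then show ?case using Cons by (simp add: proots_mult del: mult_pCons_left)
  qed simp
  ultimately have "proots (char_poly A) = mset (map f [0..<n])" by (simp only:)
  with e ev quad show ?thesis by blast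
qed

section \<open>Singular values\<close>

text \<open>The interface to \<open>singular_values\<close>. \<open>L\<close> is the full sorted
  list before truncation, one entry per eigenvector, so counting entries of \<open>L\<close> amounts
  to counting indices \<open>j\<close>.\<close>

lemma singular_values_spectral:
  assumes A: "A \<in> carrier_mat m n"
  obtains e f L where "orthonormal_family n n e"
    "\<And>j. j < n \<Longrightarrow> transpose_mat A *\<^sub>v (A *\<^sub>v e j) = f j \<cdot>\<^sub>v e j"
    "\<And>x. x \<in> carrier_vec n \<Longrightarrow> (A *\<^sub>v x) \<bullet> (A *\<^sub>v x) = (\<Sum>j<n. f j * (e j \<bullet> x)\<^sup>2)"
    "singular_values A = take (min m n) L" "sorted_wrt (\<ge>) L"
    "mset L = mset (map (\<lambda>j. sqrt (f j)) [0..<n])"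
proof -
  let ?G = "transpose_mat A * A"
  have G: "?G \<in> carrier_mat n n" and "transpose_mat ?G = ?G"
    using A by (auto simp: transpose_mult[of _ n m])
  from spectral_basis[OF this] obtain e f where e: "orthonormal_family n n e"
    and ev: "\<forall>j<n. ?G *\<^sub>v e j = f j \<cdot>\<^sub>v e j"
    and quad: "\<forall>x \<in> carrier_vec n. x \<bullet> (?G *\<^sub>v x) = (\<Sum>j<n. f j * (e j \<bullet> x)\<^sup>2)"
    and roots: "proots (char_poly ?G) = mset (map f [0..<n])" by blast
  define L where "L = rev (sorted_list_of_multiset (image_mset sqrt (proots (char_poly ?G))))"
  have Gx: "?G *\<^sub>v x = transpose_mat A *\<^sub>v (A *\<^sub>v x)" if "x \<in> carrier_vec n" for x
    using that A by (simp add: assoc_mult_mat_vec[of _ n m _ n])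
  show thesis
  proof (rule that[of e f L])
    show "transpose_mat A *\<^sub>v (A *\<^sub>v e j) = f j \<cdot>\<^sub>v e j" if "j < n" for j
      using ev e that Gx[of "e j"] by (simp add: orthonormal_family_def)
    show "(A *\<^sub>v x) \<bullet> (A *\<^sub>v x) = (\<Sum>j<n. f j * (e j \<bullet> x)\<^sup>2)" if x: "x \<in> carrier_vec n" for x
    proof -
      have Ax: "A *\<^sub>v x \<in> carrier_vec m" using A x by auto
      have "(A *\<^sub>v x) \<bullet> (A *\<^sub>v x) = (transpose_mat A *\<^sub>v (A *\<^sub>v x)) \<bullet> x"
        using transpose_vec_mult_scalar[OF A x Ax] by simp
      also have "\<dots> = x \<bullet> (?G *\<^sub>v x)"
        unfolding Gx[OF x] using A x Ax by (intro comm_scalar_prod[of _ n]) auto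
      finally show ?thesis using quad x by simp
    qed
    show "singular_values A = take (min m n) L" using A by (simp add: singular_values_def L_def)
    show "sorted_wrt (\<ge>) L" by (simp add: L_def sorted_wrt_rev)
    show "mset L = mset (map (\<lambda>j. sqrt (f j)) [0..<n])"
      by (simp add: L_def roots multiset.map_comp comp_def)
  qed fact
qed

lemma length_filter_eq_card:
  assumes "mset L = mset (map g [0..<n])"
  shows "length (filter P L) = card {j. j < n \<and> P (g j)}"
proof -
  have "length (filter P L) = size (filter_mset P (mset L))" by (simp add: size_mset[symmetric] mset_filter del: size_mset)
  also have "\<dots> = length (filter P (map g [0..<n]))" unfolding assms by (simp only: mset_filter[symmetric] size_mset)
  also have "\<dots> = card {j. j < n \<and> P (g j)}"
    by (subst length_filter_conv_card) (auto intro!: arg_cong[of _ _ card])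
  finally show ?thesis .
qed

lemma nth_ge_if_length_filter:
  fixes L :: "real list"
  assumes "sorted_wrt (\<ge>) L" "i < length (filter (\<lambda>t. c \<le> t) L)"
  shows "c \<le> L ! i"
  using assms
proof (induction L arbitrary: i)
  case (Cons a L)
  show ?case
  proof (cases "c \<le> a")
    case True
    then show ?thesis using Cons by (cases i) auto
  next
    case False
    then have "filter (\<lambda>t. c \<le> t) (a # L) = []" using Cons.prems(1) by (auto simp: filter_empty_conv)
    with Cons.prems(2) show ?thesis by simp
  qed
qed simp

lemma length_filter_take_sorted:
  fixes L :: "real list"
  assumes "sorted_wrt (\<ge>) L"
  shows "length (filter (\<lambda>t. c < t) (take k L)) = min k (length (filter (\<lambda>t. c < t) L))"
  using assms
proof (induction L arbitrary: k)
  case (Cons a L)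
  show ?case
  proof (cases "c < a")
    case True
    then show ?thesis using Cons by (cases k) auto
  next
    case False
    then have "\<forall>t \<in> set (a # L). \<not> c < t" using Cons.prems by auto
    then have "filter (\<lambda>t. c < t) (a # L) = []" "filter (\<lambda>t. c < t) (take k (a # L)) = []"
      unfolding filter_empty_conv using in_set_takeD by fast+
    then show ?thesis by simp
  qed
qed simp

text \<open>The lower half of the Courant-Fischer principle, and the source of Weyl's inequality. If
  fewer than \<open>r\<close> eigenvectors satisfied \<open>\<theta> \<le> sqrt (f j)\<close>, some
  nonzero vector in the span of \<open>u\<close> would be orthogonal to all of them, and
  \<open>A\<close> would stretch it by less than \<open>\<theta>\<close>.\<close>

lemma singular_value_ge:
  assumes A: "A \<in> carrier_mat m n" and u: "orthonormal_family n r u" and \<theta>: "0 \<le> \<theta>"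
    and low: "\<And>q. q \<in> carrier_vec r \<Longrightarrow> \<theta>\<^sup>2 * (q \<bullet> q) \<le> (A *\<^sub>v (family_mat n r u *\<^sub>v q)) \<bullet> (A *\<^sub>v (family_mat n r u *\<^sub>v q))"
    and i: "i < r" and r: "r \<le> min m n"
  shows "\<theta> \<le> singular_values A ! i"
proof -
  obtain e f L where e: "orthonormal_family n n e"
    and quad: "\<And>x. x \<in> carrier_vec n \<Longrightarrow> (A *\<^sub>v x) \<bullet> (A *\<^sub>v x) = (\<Sum>j<n. f j * (e j \<bullet> x)\<^sup>2)"
    and sv: "singular_values A = take (min m n) L" and L: "sorted_wrt (\<ge>) L"
    and ms: "mset L = mset (map (\<lambda>j. sqrt (f j)) [0..<n])"
    by (rule singular_values_spectral[OF A]) blast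
  have uc: "u i \<in> carrier_vec n" if "i < r" for i using u that by (simp add: orthonormal_family_def)
  define J where "J = {j. j < n \<and> \<theta> \<le> sqrt (f j)}"
  have fJ: "finite J" by (simp add: J_def)
  have "r \<le> card J"
  proof (rule ccontr)
    assume "\<not> r \<le> card J"
    then have less: "card J < r" by simp
    obtain h where h: "bij_betw h {..<card J} J"
      using fJ bij_betw_from_nat_into_finite by blast
    \<comment> \<open>The fewer than \<open>r\<close> orthogonality conditions are padded with zero
      rows to a square system. Row \<open>card J\<close> exists and is zero, so the determinant
      vanishes and a nonzero solution \<open>q\<close> exists.\<close>
    define N where "N = Matrix.mat r r (\<lambda>(k, i). if k < card J then e (h k) \<bullet> u i else 0)"
    have N: "N \<in> carrier_mat r r" by (simp add: N_def)
    have "N = mat\<^sub>r r r (\<lambda>k. if k = card J then 0\<^sub>v r else Matrix.row N k)"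
      by (rule eq_matI) (auto simp: N_def)
    moreover have "Determinant.det (mat\<^sub>r r r (\<lambda>k. if k = card J then 0\<^sub>v r else Matrix.row N k)) = 0"
      by (rule det_row_0[OF less]) (use N in auto)
    ultimately have "Determinant.det N = 0" by simp
    then obtain q where q: "q \<in> carrier_vec r" "q \<noteq> 0\<^sub>v r" "N *\<^sub>v q = 0\<^sub>v r"
      using det_0_iff_vec_prod_zero[OF N] by blast
    define x where "x = family_mat n r u *\<^sub>v q"
    have x: "x \<in> carrier_vec n" by (simp add: x_def)
    have xx: "x \<bullet> x = q \<bullet> q" unfolding x_def by (rule family_mat_isometry[OF u q(1) q(1)])
    have ex: "e j \<bullet> x = (\<Sum>i<r. (e j \<bullet> u i) * q $ i)" if "j < n" for j
    proof -
      have "e j \<bullet> x = (\<Sum>k<n. e j $ k * (\<Sum>i<r. q $ i * u i $ k))"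
        using x q(1) by (simp add: scalar_prod_def lessThan_atLeast0 x_def family_mat_mult_vec_index del: index_mult_mat_vec)
      also have "\<dots> = (\<Sum>i<r. \<Sum>k<n. e j $ k * (q $ i * u i $ k))"
        unfolding sum_distrib_left by (rule sum.swap)
      also have "\<dots> = (\<Sum>i<r. (e j \<bullet> u i) * q $ i)"
      proof (intro sum.cong refl)
        fix i assume "i \<in> {..<r}"
        then have "dim_vec (u i) = n" using uc by auto
        then show "(\<Sum>k<n. e j $ k * (q $ i * u i $ k)) = (e j \<bullet> u i) * q $ i"
          by (simp add: scalar_prod_def lessThan_atLeast0 sum_distrib_left mult_ac)
      qed
      finally show ?thesis .
    qed
    have zero: "e j \<bullet> x = 0" if j: "j \<in> J" for j
    proof -
      obtain k where k: "k < card J" "h k = j" using h j unfolding bij_betw_def by (metis imageE lessThan_iff)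
      have "(N *\<^sub>v q) $ k = (\<Sum>i<r. (e j \<bullet> u i) * q $ i)"
        using k less q(1) by (simp add: N_def scalar_prod_def[of _ q] lessThan_atLeast0)
      then show ?thesis using q(3) k less ex[of j] j by (simp add: J_def)
    qed
    have "(\<Sum>j<n. (\<theta>\<^sup>2 - f j) * (e j \<bullet> x)\<^sup>2) = \<theta>\<^sup>2 * (x \<bullet> x) - (A *\<^sub>v x) \<bullet> (A *\<^sub>v x)"
      unfolding quad[OF x] parseval[OF e x, symmetric]
      by (simp add: left_diff_distrib sum_subtractf sum_distrib_left)
    also have "\<dots> \<le> 0" using low[OF q(1)] by (simp add: xx x_def[symmetric])
    finally have le: "(\<Sum>j<n. (\<theta>\<^sup>2 - f j) * (e j \<bullet> x)\<^sup>2) \<le> 0" .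
    have pos: "\<theta>\<^sup>2 - f j > 0" if "j < n" "j \<notin> J" for j
    proof -
      \<comment> \<open>\<open>sqrt\<close> is extended to negative numbers as an odd function and
        increases strictly on all reals, so negative \<open>f j\<close> are covered.\<close>
      have "sqrt (f j) < sqrt (\<theta>\<^sup>2)" using that \<theta> by (auto simp: J_def)
      then show ?thesis by (simp only: real_sqrt_less_iff diff_gt_0_iff_gt)
    qed
    have nn: "0 \<le> (\<theta>\<^sup>2 - f j) * (e j \<bullet> x)\<^sup>2" if "j < n" for j
      using zero[of j] pos[OF that] by (cases "j \<in> J") auto
    have "(\<Sum>j<n. (\<theta>\<^sup>2 - f j) * (e j \<bullet> x)\<^sup>2) = 0"
      using le nn by (intro antisym sum_nonneg) auto
    then have "\<forall>j<n. (\<theta>\<^sup>2 - f j) * (e j \<bullet> x)\<^sup>2 = 0"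
      using nn by (subst (asm) sum_nonneg_eq_0_iff) auto
    then have "\<forall>j<n. e j \<bullet> x = 0" using zero pos by fastforce
    then have "q \<bullet> q = 0" using parseval[OF e x] xx by simp
    then show False using q scalar_prod_self_eq_0 by blast
  qed
  also have "card J = length (filter (\<lambda>t. \<theta> \<le> t) L)"
    unfolding J_def by (rule length_filter_eq_card[OF ms, symmetric])
  finally have "i < length (filter (\<lambda>t. \<theta> \<le> t) L)" using i by simp
  then have "\<theta> \<le> L ! i" by (rule nth_ge_if_length_filter[OF L])
  then show ?thesis using i r by (simp add: sv)
qed

section \<open>Singular value decomposition and distance to singular subspaces\<close>

lemma singular_triples_mat:
  assumes A: "A \<in> carrier_mat m n" and t: "singular_triples A r s v u"
  shows "A * family_mat n r u = family_mat m r v * mat_diag r s"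
    and "transpose_mat A * family_mat m r v = family_mat n r u * mat_diag r s"
proof -
  have v: "v j \<in> carrier_vec m" and u: "u j \<in> carrier_vec n"
    and Au: "A *\<^sub>v u j = s j \<cdot>\<^sub>v v j" and Av: "transpose_mat A *\<^sub>v v j = s j \<cdot>\<^sub>v u j" if "j < r" for j
    using t A that by (auto simp: singular_triples_def orthonormal_family_def)
  have col: "col (family_mat k r w) j = w j" if "j < r" "w j \<in> carrier_vec k" for k w j
    using that by (intro eq_vecI) (auto simp: family_mat_def)
  show "A * family_mat n r u = family_mat m r v * mat_diag r s"
  proof (rule eq_matI)
    fix i j assume "i < dim_row (family_mat m r v * mat_diag r s)" "j < dim_col (family_mat m r v * mat_diag r s)"
    then have i: "i < m" and j: "j < r" by (auto simp: mat_diag_def)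
    have "(A * family_mat n r u) $$ (i, j) = (A *\<^sub>v u j) $ i"
      using A i j u[OF j] by (simp add: col)
    also have "\<dots> = (family_mat m r v * mat_diag r s) $$ (i, j)"
      using i j v[OF j] by (simp add: Au mat_diag_mult_right[of _ m r] family_mat_def)
    finally show "(A * family_mat n r u) $$ (i, j) = (family_mat m r v * mat_diag r s) $$ (i, j)" .
  qed (use A in \<open>auto simp: mat_diag_def\<close>)
  show "transpose_mat A * family_mat m r v = family_mat n r u * mat_diag r s"
  proof (rule eq_matI)
    fix i j assume "i < dim_row (family_mat n r u * mat_diag r s)" "j < dim_col (family_mat n r u * mat_diag r s)"
    then have i: "i < n" and j: "j < r" by (auto simp: mat_diag_def)
    have "(transpose_mat A * family_mat m r v) $$ (i, j) = (transpose_mat A *\<^sub>v v j) $ i"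
      using A i j v[OF j] by (simp add: col)
    also have "\<dots> = (family_mat n r u * mat_diag r s) $$ (i, j)"
      using i j u[OF j] by (simp add: Av mat_diag_mult_right[of _ n r] family_mat_def)
    finally show "(transpose_mat A * family_mat m r v) $$ (i, j) = (family_mat n r u * mat_diag r s) $$ (i, j)" .
  qed (use A in \<open>auto simp: mat_diag_def\<close>)
qed

lemma eq_mat_if_mult_vec_eq:
  fixes A B :: "real mat"
  assumes A: "A \<in> carrier_mat m n" and B: "B \<in> carrier_mat m n"
    and eq: "\<And>x. x \<in> carrier_vec n \<Longrightarrow> A *\<^sub>v x = B *\<^sub>v x"
  shows "A = B"
proof (rule eq_matI)
  fix i j assume "i < dim_row B" "j < dim_col B"
  then have ij: "i < m" "j < n" using B by auto
  have "(X *\<^sub>v unit_vec n j) $ i = X $$ (i, j)" if "X \<in> carrier_mat m n" for X :: "real mat"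
    using that ij by auto
  from this[OF A] this[OF B] show "A $$ (i, j) = B $$ (i, j)" using eq[of "unit_vec n j"] by simp
qed (use A B in auto)

text \<open>Double counting of the squared coordinates: summed by vectors they give
  \<open>r\<close>; summed by coordinates, Bessel's inequality for each unit vector gives at most
  \<open>n\<close>.\<close>

lemma orthonormal_family_length_le:
  assumes "orthonormal_family n r u"
  shows "r \<le> n"
proof -
  have uc: "u i \<in> carrier_vec n" "u i \<bullet> u i = 1" if "i < r" for i
    using assms that by (auto simp: orthonormal_family_def)
  have "real r = (\<Sum>i<r. u i \<bullet> u i)" using uc by simp
  also have "\<dots> = (\<Sum>i<r. \<Sum>k<n. (u i \<bullet> unit_vec n k)\<^sup>2)"
    using uc(1) by (intro sum.cong refl) (simp add: scalar_prod_self)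
  also have "\<dots> = (\<Sum>k<n. \<Sum>i<r. (u i \<bullet> unit_vec n k)\<^sup>2)" by (rule sum.swap)
  also have "\<dots> \<le> (\<Sum>k<n. unit_vec n k \<bullet> unit_vec n k)"
    using assms by (intro sum_mono bessel_inequality) auto
  also have "\<dots> = real n" by simp
  finally show ?thesis by simp
qed

text \<open>The positive singular values being listed in full forces the triples to exhaust the row space:
  the traces of the projections onto \<open>u\<close> and onto the positive eigenspaces of \<open>B\<^sup>T B\<close> agree.\<close>

lemma singular_value_decomposition:
  assumes B: "B \<in> carrier_mat m n"
    and s: "filter (\<lambda>t. 0 < t) (singular_values B) = map s [0..<r]"
    and t: "singular_triples B r s v u"
  shows "B = family_mat m r v * mat_diag r s * transpose_mat (family_mat n r u)"
proof -
  let ?U = "family_mat n r u" and ?V = "family_mat m r v" and ?S = "mat_diag r s"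
  have u: "orthonormal_family n r u" and v: "orthonormal_family m r v"
    and Bu: "\<And>i. i < r \<Longrightarrow> B *\<^sub>v u i = s i \<cdot>\<^sub>v v i"
    and Bv: "\<And>i. i < r \<Longrightarrow> transpose_mat B *\<^sub>v v i = s i \<cdot>\<^sub>v u i"
    using t B by (auto simp: singular_triples_def)
  note BU = singular_triples_mat[OF B t]
  have s_pos: "s i > 0" if "i < r" for i
  proof -
    have "s i \<in> set (filter (\<lambda>t. 0 < t) (singular_values B))" unfolding s using that by simp
    then show ?thesis by simp
  qed
  have uc: "u i \<in> carrier_vec n" "u i \<bullet> u i = 1" if "i < r" for i
    using u that by (auto simp: orthonormal_family_def)
  have vc: "v i \<in> carrier_vec m" if "i < r" for i using v that by (auto simp: orthonormal_family_def)
  obtain e f L where e: "orthonormal_family n n e"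
    and ev: "\<And>j. j < n \<Longrightarrow> transpose_mat B *\<^sub>v (B *\<^sub>v e j) = f j \<cdot>\<^sub>v e j"
    and quad: "\<And>x. x \<in> carrier_vec n \<Longrightarrow> (B *\<^sub>v x) \<bullet> (B *\<^sub>v x) = (\<Sum>j<n. f j * (e j \<bullet> x)\<^sup>2)"
    and sv: "singular_values B = take (min m n) L" and L: "sorted_wrt (\<ge>) L"
    and ms: "mset L = mset (map (\<lambda>j. sqrt (f j)) [0..<n])"
    by (rule singular_values_spectral[OF B]) blast
  have ec: "e j \<in> carrier_vec n" "e j \<bullet> e j = 1" if "j < n" for j
    using e that by (auto simp: orthonormal_family_def)
  define J where "J = {j. j < n \<and> 0 < f j}"
  have J: "finite J" "J \<subseteq> {..<n}" by (auto simp: J_def)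
  have "r = length (filter (\<lambda>t. 0 < t) (singular_values B))" by (simp add: s)
  also have "\<dots> = min (min m n) (card J)"
    unfolding sv length_filter_take_sorted[OF L] length_filter_eq_card[OF ms] by (simp add: J_def)
  finally have r: "r = min (min m n) (card J)" .
  have "card J \<le> n" using card_mono[OF _ J(2)] by simp
  \<comment> \<open>The truncation in \<open>singular_values\<close> may be what limits
    \<open>r\<close>. Then \<open>r = m\<close>, and the columns of \<open>?V\<close> already form a
    basis of the left space. Otherwise \<open>r\<close> is the number of positive eigenvalues, and
    the traces can be compared.\<close>
  with r consider "r = m" | "r = card J" by linarith
  then show ?thesis
  proof cases
    case 1
    have "?V * transpose_mat ?V = 1\<^sub>m m"
      using mat_mult_left_right_inverse[OF _ _ family_mat_orthonormal[OF v]] 1 by simp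
    then have "B = ?V * transpose_mat ?V * B" using B by simp
    also have "\<dots> = ?V * (transpose_mat ?V * B)" using B by (intro assoc_mult_mat[of _ m r _ m _ n]) auto
    also have "transpose_mat ?V * B = transpose_mat (transpose_mat B * ?V)"
      using B by (subst transpose_mult[of _ n m]) auto
    also have "\<dots> = transpose_mat ?S * transpose_mat ?U"
      unfolding BU by (rule transpose_mult[of _ n r _ r]) auto
    also have "transpose_mat ?S = ?S" by (rule eq_matI) (auto simp: mat_diag_def)
    also have "?V * (?S * transpose_mat ?U) = ?V * ?S * transpose_mat ?U"
      by (intro assoc_mult_mat[of _ m r _ r _ n, symmetric]) auto
    finally show ?thesis .
  next
    case 2
    \<comment> \<open>Eigenvectors for distinct eigenvalues: \<open>u i\<close> belongs to
      \<open>s i * s i > 0\<close>, whereas \<open>f j \<le> 0\<close> outside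
      \<open>J\<close>.\<close>
    have orth: "u i \<bullet> e j = 0" if i: "i < r" and j: "j < n" "j \<notin> J" for i j
    proof -
      have Be: "B *\<^sub>v e j \<in> carrier_vec m" using B ec[OF j(1)] by auto
      have "f j * (u i \<bullet> e j) = (f j \<cdot>\<^sub>v e j) \<bullet> u i"
        using uc(1)[OF i] ec(1)[OF j(1)] comm_scalar_prod[OF uc(1)[OF i] ec(1)[OF j(1)]] by simp
      also have "\<dots> = (transpose_mat B *\<^sub>v (B *\<^sub>v e j)) \<bullet> u i" by (simp add: ev[OF j(1)])
      also have "\<dots> = (B *\<^sub>v e j) \<bullet> (B *\<^sub>v u i)" by (rule transpose_vec_mult_scalar[OF B uc(1)[OF i] Be])
      also have "\<dots> = s i * (v i \<bullet> (B *\<^sub>v e j))"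
        unfolding Bu[OF i] using vc[OF i] Be comm_scalar_prod[OF Be vc[OF i]] by simp
      also have "v i \<bullet> (B *\<^sub>v e j) = (transpose_mat B *\<^sub>v v i) \<bullet> e j"
        by (rule transpose_vec_mult_scalar[OF B ec(1)[OF j(1)] vc[OF i], symmetric])
      also have "\<dots> = s i * (u i \<bullet> e j)" using uc[OF i] ec[OF j(1)] by (simp add: Bv[OF i])
      finally have "(s i * s i - f j) * (u i \<bullet> e j) = 0" by (simp only: left_diff_distrib diff_self)
      moreover have "s i * s i > 0" using s_pos[OF i] by simp
      ultimately show ?thesis using j by (auto simp: J_def)
    qed
    have one: "(\<Sum>j\<in>J. (u i \<bullet> e j)\<^sup>2) = 1" if i: "i < r" for i
    proof -
      have "(\<Sum>j\<in>J. (u i \<bullet> e j)\<^sup>2) = (\<Sum>j<n. (u i \<bullet> e j)\<^sup>2)"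
        using J orth[OF i] by (intro sum.mono_neutral_left) auto
      also have "\<dots> = (\<Sum>j<n. (e j \<bullet> u i)\<^sup>2)"
        using comm_scalar_prod[OF uc(1)[OF i] ec(1)] by (intro sum.cong refl) simp
      also have "\<dots> = 1" using parseval[OF e uc(1)[OF i]] uc(2)[OF i] by simp
      finally show ?thesis .
    qed
    have "(\<Sum>j\<in>J. 1 - (\<Sum>i<r. (u i \<bullet> e j)\<^sup>2)) = card J - (\<Sum>i<r. \<Sum>j\<in>J. (u i \<bullet> e j)\<^sup>2)"
      by (simp add: sum_subtractf sum.swap[of _ J])
    also have "\<dots> = 0" using one 2 by simp
    finally have sum0: "(\<Sum>j\<in>J. 1 - (\<Sum>i<r. (u i \<bullet> e j)\<^sup>2)) = 0" .
    have "1 - (\<Sum>i<r. (u i \<bullet> e j)\<^sup>2) \<ge> 0" if "j \<in> J" for j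
      using bessel_inequality[OF u ec(1)] ec(2) that J(2) by (auto simp: subset_iff)
    then have full: "(\<Sum>i<r. (u i \<bullet> e j)\<^sup>2) = 1" if "j \<in> J" for j
      using sum0 that J(1) by (subst (asm) sum_nonneg_eq_0_iff) auto
    have span: "?U *\<^sub>v (transpose_mat ?U *\<^sub>v e j) = e j" if "j \<in> J" for j
      using bessel_equality[OF u ec(1)] ec(2) full[OF that] that J(2) by (auto simp: subset_iff)
    \<comment> \<open>\<open>B\<close> annihilates the residual \<open>x - ?p\<close>: it is
      orthogonal to each \<open>e j\<close> with \<open>j \<in> J\<close>, as these lie in the span
      of \<open>u\<close>, and the other terms of the quadratic form have
      \<open>f j \<le> 0\<close>.\<close>
    have BUx: "B *\<^sub>v x = B *\<^sub>v (?U *\<^sub>v (transpose_mat ?U *\<^sub>v x))" if x: "x \<in> carrier_vec n" for x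
    proof -
      let ?p = "?U *\<^sub>v (transpose_mat ?U *\<^sub>v x)"
      have xp: "x - ?p \<in> carrier_vec n" using x by simp
      have zero: "e j \<bullet> (x - ?p) = 0" if "j \<in> J" for j
      proof -
        have ej: "e j \<in> carrier_vec n" using ec that J(2) by auto
        have "e j \<bullet> ?p = (transpose_mat ?U *\<^sub>v e j) \<bullet> (transpose_mat ?U *\<^sub>v x)"
          using transpose_vec_mult_scalar[of ?U n r "transpose_mat ?U *\<^sub>v x" "e j"] ej by simp
        also have "\<dots> = (transpose_mat ?U *\<^sub>v x) \<bullet> (transpose_mat ?U *\<^sub>v e j)"
          by (rule comm_scalar_prod[of _ r]) auto
        also have "\<dots> = x \<bullet> (?U *\<^sub>v (transpose_mat ?U *\<^sub>v e j))"
          by (rule transpose_vec_mult_scalar[of _ n r]) (use x in auto)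
        also have "\<dots> = e j \<bullet> x" unfolding span[OF that] by (rule comm_scalar_prod[OF x ej])
        finally show ?thesis using ej x by (simp add: scalar_prod_minus_distrib[of _ n])
      qed
      have "(B *\<^sub>v (x - ?p)) \<bullet> (B *\<^sub>v (x - ?p)) = (\<Sum>j<n. f j * (e j \<bullet> (x - ?p))\<^sup>2)"
        by (rule quad[OF xp])
      also have "\<dots> \<le> 0"
      proof (rule sum_nonpos)
        fix j assume "j \<in> {..<n}"
        then show "f j * (e j \<bullet> (x - ?p))\<^sup>2 \<le> 0"
          using zero[of j] by (cases "j \<in> J") (auto simp: J_def mult_le_0_iff)
      qed
      finally have "(B *\<^sub>v (x - ?p)) \<bullet> (B *\<^sub>v (x - ?p)) = 0"
        using scalar_prod_self_nonneg[of "B *\<^sub>v (x - ?p)"] by simp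
      then have "B *\<^sub>v (x - ?p) = 0\<^sub>v m"
        using scalar_prod_self_eq_0[of "B *\<^sub>v (x - ?p)" m] B xp by simp
      then have 0: "B *\<^sub>v x - B *\<^sub>v ?p = 0\<^sub>v m"
        using mult_minus_distrib_mat_vec[OF B x, of ?p] by simp
      show ?thesis
      proof (rule eq_vecI)
        fix i assume i: "i < dim_vec (B *\<^sub>v ?p)"
        then have "(B *\<^sub>v x - B *\<^sub>v ?p) $ i = 0" unfolding 0 using B by simp
        then show "(B *\<^sub>v x) $ i = (B *\<^sub>v ?p) $ i" using i by simp
      qed (use B in auto)
    qed
    have "B = B * ?U * transpose_mat ?U"
    proof (rule eq_mat_if_mult_vec_eq[OF B])
      fix x :: "real vec" assume x: "x \<in> carrier_vec n"
      have "B * ?U * transpose_mat ?U *\<^sub>v x = (B * ?U) *\<^sub>v (transpose_mat ?U *\<^sub>v x)"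
        using B x by (intro assoc_mult_mat_vec[of _ m r _ n]) auto
      also have "\<dots> = B *\<^sub>v (?U *\<^sub>v (transpose_mat ?U *\<^sub>v x))"
        using B x by (intro assoc_mult_mat_vec[of _ m n _ r]) auto
      finally show "B *\<^sub>v x = B * ?U * transpose_mat ?U *\<^sub>v x" using BUx[OF x] by simp
    qed (use B in auto)
    then show ?thesis unfolding BU .
  qed
qed

lemma dist_subspace_bounds:
  assumes "f \<in> F"
  shows "0 \<le> dist_subspace x F" and "dist_subspace x F \<le> vec_norm2 (x - f)"
proof -
  show "0 \<le> dist_subspace x F" unfolding dist_subspace_def
    using assms by (intro cINF_greatest) (auto simp: vec_norm2_nonneg)
  show "dist_subspace x F \<le> vec_norm2 (x - f)" unfolding dist_subspace_def
    using assms by (intro cINF_lower bdd_belowI2[of _ 0]) (auto simp: vec_norm2_nonneg)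
qed

lemma family_mat_mult_in_vec_span:
  assumes u: "\<And>i. i < r \<Longrightarrow> u i \<in> carrier_vec n" and q: "q \<in> carrier_vec r"
  shows "family_mat n r u *\<^sub>v q \<in> vec_span n (u ` {..<r})"
proof -
  interpret vec_space "TYPE(real)" n .
  have sub: "u ` {..<r} \<subseteq> carrier_vec n" using u by auto
  define g where "g k = Matrix.vec n (\<lambda>i. \<Sum>j<k. q $ j * u j $ i)" for k
  have "g k \<in> span (u ` {..<r})" if "k \<le> r" for k
    using that
  proof (induction k)
    case 0
    have "g 0 = 0\<^sub>v n" by (auto simp: g_def)
    then show ?case using vectorspace.span_zero[OF vectorspace_axioms, of "u ` {..<r}"] by simp
  next
    case (Suc k)
    have "g (Suc k) = g k + q $ k \<cdot>\<^sub>v u k" using u[of k] Suc.prems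
      by (intro eq_vecI) (auto simp: g_def)
    moreover have "u k \<in> span (u ` {..<r})" using Suc.prems span_mem[OF sub] by auto
    ultimately show ?case using Suc span_add1[OF sub] smult_in_span[OF sub] by auto
  qed
  moreover have "family_mat n r u *\<^sub>v q = g r"
    using q by (intro eq_vecI) (auto simp: g_def family_mat_mult_vec_index simp del: index_mult_mat_vec)
  ultimately show ?thesis unfolding vec_span_def by simp
qed

lemma dist_subspace_le_residual:
  assumes u: "\<And>i. i < r \<Longrightarrow> u i \<in> carrier_vec n" and q: "q \<in> carrier_vec r"
    and y: "y \<in> carrier_vec n" and w: "w \<in> carrier_vec n"
    and eq: "z \<cdot>\<^sub>v y = family_mat n r u *\<^sub>v q + w"
    and \<theta>: "0 < \<theta>" "\<theta> \<le> z" and \<epsilon>: "vec_norm2 w \<le> \<epsilon>"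
  shows "(dist_subspace y (vec_span n (u ` {..<r})))\<^sup>2 \<le> \<epsilon>\<^sup>2 / \<theta>\<^sup>2"
proof -
  let ?F = "vec_span n (u ` {..<r})"
  let ?f = "family_mat n r u *\<^sub>v ((1 / z) \<cdot>\<^sub>v q)"
  have f: "?f \<in> ?F" using q by (intro family_mat_mult_in_vec_span u) auto
  have f': "?f = (1 / z) \<cdot>\<^sub>v (family_mat n r u *\<^sub>v q)" using q by (intro mult_mat_vec) auto
  have z: "z > 0" using \<theta> by simp
  have "y - ?f = (1 / z) \<cdot>\<^sub>v w"
  proof (rule eq_vecI)
    fix i assume "i < dim_vec ((1 / z) \<cdot>\<^sub>v w)"
    then have i: "i < n" using w by simp
    have "z * y $ i = (family_mat n r u *\<^sub>v q) $ i + w $ i"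
      using arg_cong[OF eq, of "\<lambda>x. x $ i"] i y w by (simp del: index_mult_mat_vec)
    then show "(y - ?f) $ i = ((1 / z) \<cdot>\<^sub>v w) $ i"
      unfolding f' using i y w z by (simp add: field_simps del: index_mult_mat_vec)
  qed (use y w in auto)
  then have "dist_subspace y ?F \<le> vec_norm2 w / z"
    using dist_subspace_bounds(2)[OF f, of y] z by (simp add: vec_norm2_smult)
  also have "\<dots> \<le> \<epsilon> / \<theta>" using \<theta> \<epsilon> vec_norm2_nonneg[of w] by (intro frac_le) auto
  finally have "dist_subspace y ?F \<le> \<epsilon> / \<theta>" .
  then have "(dist_subspace y ?F)\<^sup>2 \<le> (\<epsilon> / \<theta>)\<^sup>2"
    using dist_subspace_bounds(1)[OF f] by (intro power_mono) auto
  then show ?thesis by (simp add: power_divide)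
qed

text \<open>A real \<open>Sup\<close> carries information only when its set is bounded above; the
  premise on \<open>T\<close> supplies this. In the application \<open>T\<close> is the almost sure
  noise bound.\<close>

lemma spectral_norm_le:
  assumes W: "W \<in> carrier_mat m n"
    and T: "\<And>x. x \<in> carrier_vec n \<Longrightarrow> vec_norm2 x \<le> 1 \<Longrightarrow> vec_norm2 (W *\<^sub>v x) \<le> T"
  shows "spectral_norm W \<le> T"
    and "x \<in> carrier_vec n \<Longrightarrow> vec_norm2 (W *\<^sub>v x) \<le> spectral_norm W * vec_norm2 x"
    and "y \<in> carrier_vec m \<Longrightarrow> vec_norm2 (transpose_mat W *\<^sub>v y) \<le> spectral_norm W * vec_norm2 y"
    and "0 \<le> spectral_norm W"
proof -
  let ?S = "{vec_norm2 (W *\<^sub>v x) | x. x \<in> carrier_vec (dim_col W) \<and> vec_norm2 x \<le> 1}"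
  have bdd: "bdd_above ?S" using T W by (intro bdd_aboveI[of _ T]) auto
  have "vec_norm2 (0\<^sub>v n) \<le> 1" by (simp add: vec_norm2_def)
  then have ne: "?S \<noteq> {}" using W by (auto intro!: exI[of _ "0\<^sub>v n"])
  show "spectral_norm W \<le> T" unfolding spectral_norm_def
    using ne T W by (intro cSup_least) auto
  show nonneg: "0 \<le> spectral_norm W"
    unfolding spectral_norm_def using ne vec_norm2_nonneg bdd by (fastforce intro: cSup_upper2)
  have bound: "vec_norm2 (W *\<^sub>v x) \<le> spectral_norm W * vec_norm2 x" if x: "x \<in> carrier_vec n" for x
  proof (cases "vec_norm2 x = 0")
    case True
    then have "x \<bullet> x = 0" using vec_norm2_power2[of x] by simp
    then have "x = 0\<^sub>v n" using scalar_prod_self_eq_0[OF x] by simp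
    then have "W *\<^sub>v x = 0\<^sub>v m" using W by (auto intro!: eq_vecI)
    then show ?thesis using True by (simp add: vec_norm2_def)
  next
    case False
    then have pos: "vec_norm2 x > 0" using vec_norm2_nonneg[of x] by simp
    let ?y = "(1 / vec_norm2 x) \<cdot>\<^sub>v x"
    have "vec_norm2 (W *\<^sub>v ?y) \<le> spectral_norm W" unfolding spectral_norm_def
      using x W pos by (intro cSup_upper[OF _ bdd]) (auto intro!: exI[of _ ?y] simp: vec_norm2_smult)
    moreover have "W *\<^sub>v ?y = (1 / vec_norm2 x) \<cdot>\<^sub>v (W *\<^sub>v x)" by (rule mult_mat_vec[OF W x])
    ultimately show ?thesis using pos by (simp add: vec_norm2_smult field_simps)
  qed
  then show "x \<in> carrier_vec n \<Longrightarrow> vec_norm2 (W *\<^sub>v x) \<le> spectral_norm W * vec_norm2 x" .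
  show "vec_norm2 (transpose_mat W *\<^sub>v y) \<le> spectral_norm W * vec_norm2 y" if y: "y \<in> carrier_vec m"
  proof -
    \<comment> \<open>The transpose inherits the bound: moving it across the inner product gives
      \<open>y \<bullet> (W *\<^sub>v ?x)\<close>, and after Cauchy-Schwarz one factor
      \<open>vec_norm2 ?x\<close> cancels.\<close>
    let ?x = "transpose_mat W *\<^sub>v y"
    have x: "?x \<in> carrier_vec n" using W y by auto
    have "(vec_norm2 ?x)\<^sup>2 = y \<bullet> (W *\<^sub>v ?x)"
      unfolding vec_norm2_power2 by (rule transpose_vec_mult_scalar[OF W x y])
    also have "\<dots> \<le> vec_norm2 y * vec_norm2 (W *\<^sub>v ?x)"
      using W x y by (intro scalar_prod_le_vec_norm2) auto
    also have "\<dots> \<le> vec_norm2 y * (spectral_norm W * vec_norm2 ?x)"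
      using bound[OF x] vec_norm2_nonneg by (intro mult_left_mono) auto
    finally have "vec_norm2 ?x * vec_norm2 ?x \<le> (spectral_norm W * vec_norm2 y) * vec_norm2 ?x"
      by (simp add: power2_eq_square mult_ac)
    moreover have "0 \<le> spectral_norm W * vec_norm2 y"
      using nonneg vec_norm2_nonneg by simp
    ultimately show ?thesis using vec_norm2_nonneg[of ?x]
      by (cases "vec_norm2 ?x = 0") (auto dest: mult_right_le_imp_le)
  qed
qed

section \<open>Singular values of blown-up matrices\<close>

text \<open>Gram--Schmidt, one row at a time: a row that depends on the previous ones gets coefficient \<open>0\<close>,
  so the bound survives linear dependence.\<close>

lemma bounded_projection_coefficients:
  fixes p :: "nat \<Rightarrow> nat \<Rightarrow> real"
  shows "\<exists>L\<ge>0. \<forall>w \<beta>. 0 \<le> \<beta> \<and> (\<forall>l<b. \<bar>w l\<bar> \<le> \<beta>) \<longrightarrow>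
    (\<exists>q. (\<forall>k<a. \<bar>q k\<bar> \<le> L * \<beta>) \<and> (\<forall>k<a. (\<Sum>l<b. (w l - (\<Sum>k'<a. q k' * p k' l)) * p k l) = 0))"
proof (induction a)
  case (Suc a)
  then obtain L where L: "L \<ge> 0" and IH: "\<And>w \<beta>. 0 \<le> \<beta> \<Longrightarrow> (\<And>l. l < b \<Longrightarrow> \<bar>w l\<bar> \<le> \<beta>) \<Longrightarrow>
    \<exists>q. (\<forall>k<a. \<bar>q k\<bar> \<le> L * \<beta>) \<and> (\<forall>k<a. (\<Sum>l<b. (w l - (\<Sum>k'<a. q k' * p k' l)) * p k l) = 0)"
    by blast
  define \<beta>0 where "\<beta>0 = (\<Sum>l<b. \<bar>p a l\<bar>)"
  have \<beta>0: "0 \<le> \<beta>0" by (simp add: \<beta>0_def sum_nonneg)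
  have "\<bar>p a l\<bar> \<le> \<beta>0" if "l < b" for l
    unfolding \<beta>0_def using that by (intro member_le_sum) auto
  \<comment> \<open>The new row itself is projected onto the earlier ones, with coefficients
    \<open>t\<close>. The remainder \<open>p'\<close> is the Gram-Schmidt vector and
    \<open>D\<close> its squared length, so \<open>D = 0\<close> is the case of a dependent
    row.\<close>
  from IH[of \<beta>0 "p a", OF \<beta>0 this] obtain t where t: "\<And>k. k < a \<Longrightarrow> \<bar>t k\<bar> \<le> L * \<beta>0"
    and orth_t: "\<And>k. k < a \<Longrightarrow> (\<Sum>l<b. (p a l - (\<Sum>k'<a. t k' * p k' l)) * p k l) = 0" by blast
  define p' where "p' l = p a l - (\<Sum>k'<a. t k' * p k' l)" for l
  have orth': "(\<Sum>l<b. p' l * p k l) = 0" if "k < a" for k using orth_t[OF that] by (simp add: p'_def)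
  have comb: "(\<Sum>l<b. g l * (\<Sum>k<a. h k * p k l)) = (\<Sum>k<a. h k * (\<Sum>l<b. g l * p k l))" for g h
    unfolding sum_distrib_left by (subst sum.swap) (simp add: mult_ac)
  have pa: "p a l = p' l + (\<Sum>k<a. t k * p k l)" for l by (simp add: p'_def)
  define D where "D = (\<Sum>l<b. (p' l)\<^sup>2)"
  show ?case
  proof (cases "D = 0")
    case True
    then have p'0: "p' l = 0" if "l < b" for l
      using that unfolding D_def by (subst (asm) sum_nonneg_eq_0_iff) auto
    show ?thesis
    proof (intro exI[of _ L] conjI allI impI, rule L, elim conjE)
      fix w and \<beta> :: real assume \<beta>: "0 \<le> \<beta>" and w: "\<forall>l<b. \<bar>w l\<bar> \<le> \<beta>"
      then obtain q where q: "\<And>k. k < a \<Longrightarrow> \<bar>q k\<bar> \<le> L * \<beta>"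
        and orth: "\<And>k. k < a \<Longrightarrow> (\<Sum>l<b. (w l - (\<Sum>k'<a. q k' * p k' l)) * p k l) = 0"
        using IH[OF \<beta>, of w] by blast
      define q' where "q' k = (if k < a then q k else 0)" for k
      have res: "(\<Sum>k'<Suc a. q' k' * p k' l) = (\<Sum>k'<a. q k' * p k' l)" for l by (simp add: q'_def)
      have "(\<Sum>l<b. (w l - (\<Sum>k'<Suc a. q' k' * p k' l)) * p k l) = 0" if "k < Suc a" for k
      proof (cases "k < a")
        case False
        then have k: "k = a" using that by simp
        have "(\<Sum>l<b. (w l - (\<Sum>k'<a. q k' * p k' l)) * p a l)
          = (\<Sum>l<b. (w l - (\<Sum>k'<a. q k' * p k' l)) * (\<Sum>k<a. t k * p k l))"
          by (intro sum.cong) (auto simp: pa p'0)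
        also have "\<dots> = 0" unfolding comb by (simp add: orth)
        finally show ?thesis unfolding res k .
      qed (simp add: res orth del: sum.lessThan_Suc)
      moreover have "\<bar>q' k\<bar> \<le> L * \<beta>" for k using q[of k] L \<beta> by (simp add: q'_def)
      ultimately show "\<exists>q. (\<forall>k<Suc a. \<bar>q k\<bar> \<le> L * \<beta>) \<and>
          (\<forall>k<Suc a. (\<Sum>l<b. (w l - (\<Sum>k'<Suc a. q k' * p k' l)) * p k l) = 0)" by blast
    qed
  next
    case False
    then have D: "D > 0" unfolding D_def by (simp add: sum_nonneg less_le)
    define S where "S = (\<Sum>l<b. \<bar>p' l\<bar>)"
    have S: "0 \<le> S" by (simp add: S_def sum_nonneg)
    \<comment> \<open>The coefficient \<open>\<gamma>\<close> of \<open>p'\<close> is at most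
      \<open>S / D * \<beta>\<close>. Rewriting \<open>p'\<close> through the rows changes each old
      coefficient by \<open>\<gamma> * t k\<close>, which accounts for \<open>L * \<beta>0\<close>;
      the summand \<open>1\<close> covers the coefficient of the new row.\<close>
    define L' where "L' = L + S / D * (L * \<beta>0 + 1)"
    have L': "0 \<le> L'" using L \<beta>0 D S by (simp add: L'_def)
    show ?thesis
    proof (intro exI[of _ L'] conjI allI impI, rule L', elim conjE)
      fix w and \<beta> :: real assume \<beta>: "0 \<le> \<beta>" and w: "\<forall>l<b. \<bar>w l\<bar> \<le> \<beta>"
      then obtain q where q: "\<And>k. k < a \<Longrightarrow> \<bar>q k\<bar> \<le> L * \<beta>"
        and orth: "\<And>k. k < a \<Longrightarrow> (\<Sum>l<b. (w l - (\<Sum>k'<a. q k' * p k' l)) * p k l) = 0"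
        using IH[OF \<beta>, of w] by blast
      define \<gamma> where "\<gamma> = (\<Sum>l<b. w l * p' l) / D"
      have "\<bar>\<Sum>l<b. w l * p' l\<bar> \<le> (\<Sum>l<b. \<bar>w l * p' l\<bar>)" by (rule sum_abs)
      also have "\<dots> \<le> (\<Sum>l<b. \<beta> * \<bar>p' l\<bar>)"
        using w by (intro sum_mono) (auto simp: abs_mult intro!: mult_right_mono)
      also have "\<dots> = \<beta> * S" by (simp add: S_def sum_distrib_left)
      finally have \<gamma>: "\<bar>\<gamma>\<bar> \<le> S / D * \<beta>" using D by (simp add: \<gamma>_def divide_right_mono mult.commute)
      define q' where "q' k = (if k < a then q k - \<gamma> * t k else \<gamma>)" for k
      have res: "w l - (\<Sum>k'<Suc a. q' k' * p k' l) = (w l - (\<Sum>k'<a. q k' * p k' l)) - \<gamma> * p' l" for l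
        by (simp add: q'_def pa sum_subtractf left_diff_distrib right_diff_distrib distrib_left sum_distrib_left mult.assoc)
      have orth1: "(\<Sum>l<b. (w l - (\<Sum>k'<Suc a. q' k' * p k' l)) * p k l) = 0" if "k < a" for k
      proof -
        have "(\<Sum>l<b. (w l - (\<Sum>k'<Suc a. q' k' * p k' l)) * p k l)
          = (\<Sum>l<b. (w l - (\<Sum>k'<a. q k' * p k' l)) * p k l) - \<gamma> * (\<Sum>l<b. p' l * p k l)"
          unfolding res by (simp add: left_diff_distrib sum_subtractf sum_distrib_left mult.assoc)
        then show ?thesis using orth[OF that] orth'[OF that] by simp
      qed
      have orth2: "(\<Sum>l<b. (w l - (\<Sum>k'<Suc a. q' k' * p k' l)) * p' l) = 0"
      proof -
        have "(\<Sum>l<b. (w l - (\<Sum>k'<Suc a. q' k' * p k' l)) * p' l)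
          = (\<Sum>l<b. w l * p' l) - (\<Sum>l<b. (\<Sum>k'<a. q k' * p k' l) * p' l) - \<gamma> * D"
          unfolding res D_def
          by (simp add: left_diff_distrib sum_subtractf sum_distrib_left[of \<gamma>] mult.assoc power2_eq_square)
        also have "(\<Sum>l<b. (\<Sum>k'<a. q k' * p k' l) * p' l) = (\<Sum>k<a. q k * (\<Sum>l<b. p' l * p k l))"
          using comb[of p' q] by (simp only: mult.commute)
        also have "\<dots> = 0" using orth' by simp
        also have "(\<Sum>l<b. w l * p' l) - 0 - \<gamma> * D = 0" using D by (simp add: \<gamma>_def)
        finally show ?thesis .
      qed
      have "(\<Sum>l<b. (w l - (\<Sum>k'<Suc a. q' k' * p k' l)) * p k l) = 0" if "k < Suc a" for k
      proof (cases "k < a")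
        case False
        then have k: "k = a" using that by simp
        have "(\<Sum>l<b. (w l - (\<Sum>k'<Suc a. q' k' * p k' l)) * p a l)
          = (\<Sum>l<b. (w l - (\<Sum>k'<Suc a. q' k' * p k' l)) * p' l)
            + (\<Sum>l<b. (w l - (\<Sum>k'<Suc a. q' k' * p k' l)) * (\<Sum>k<a. t k * p k l))"
          unfolding sum.distrib[symmetric] by (intro sum.cong refl) (simp only: pa distrib_left)
        also have "\<dots> = 0" unfolding comb orth2 by (simp add: orth1 del: sum.lessThan_Suc)
        finally show ?thesis unfolding k .
      qed (rule orth1)
      moreover have "\<bar>q' k\<bar> \<le> L' * \<beta>" for k
      proof (cases "k < a")
        case True
        have "\<bar>q' k\<bar> \<le> \<bar>q k\<bar> + \<bar>\<gamma>\<bar> * \<bar>t k\<bar>" using True by (simp add: q'_def abs_mult[symmetric])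
        also have "\<dots> \<le> L * \<beta> + (S / D * \<beta>) * (L * \<beta>0)"
          using q[OF True] t[OF True] \<gamma> S D \<beta> by (intro add_mono mult_mono) auto
        also have "\<dots> \<le> L' * \<beta>" using S D \<beta> by (simp add: L'_def algebra_simps)
        finally show ?thesis .
      next
        case False
        then have "\<bar>q' k\<bar> \<le> S / D * \<beta>" using \<gamma> by (simp add: q'_def)
        also have "\<dots> \<le> L' * \<beta>" using S D \<beta> L \<beta>0 by (simp add: L'_def algebra_simps)
        finally show ?thesis .
      qed
      ultimately show "\<exists>q. (\<forall>k<Suc a. \<bar>q k\<bar> \<le> L' * \<beta>) \<and>
          (\<forall>k<Suc a. (\<Sum>l<b. (w l - (\<Sum>k'<Suc a. q k' * p k' l)) * p k l) = 0)" by blast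
    qed
  qed
qed auto

text \<open>The coefficients \<open>q0\<close> merely certify that \<open>w\<close> lies in the row
  space. The residual of the bounded projection then lies in the row space and is orthogonal to it,
  hence vanishes, so the bounded coefficients represent \<open>w\<close> exactly.\<close>

lemma bounded_row_space_coefficients:
  fixes p :: "nat \<Rightarrow> nat \<Rightarrow> real"
  shows "\<exists>L\<ge>0. \<forall>w \<beta> q0. 0 \<le> \<beta> \<and> (\<forall>l<b. \<bar>w l\<bar> \<le> \<beta>) \<and> (\<forall>l<b. w l = (\<Sum>k<a. q0 k * p k l)) \<longrightarrow>
    (\<exists>q. (\<forall>k<a. \<bar>q k\<bar> \<le> L * \<beta>) \<and> (\<forall>l<b. w l = (\<Sum>k<a. q k * p k l)))"
proof -
  obtain L where L: "L \<ge> 0" and proj: "\<And>w \<beta>. 0 \<le> \<beta> \<and> (\<forall>l<b. \<bar>w l\<bar> \<le> \<beta>) \<Longrightarrow>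
    \<exists>q. (\<forall>k<a. \<bar>q k\<bar> \<le> L * \<beta>) \<and> (\<forall>k<a. (\<Sum>l<b. (w l - (\<Sum>k'<a. q k' * p k' l)) * p k l) = 0)"
    using bounded_projection_coefficients[of b a p] by blast
  show ?thesis
  proof (intro exI[of _ L] conjI allI impI, rule L, elim conjE)
    fix w \<beta> q0 assume \<beta>: "0 \<le> \<beta>" "\<forall>l<b. \<bar>w l\<bar> \<le> \<beta>" and w: "\<forall>l<b. w l = (\<Sum>k<a. q0 k * p k l)"
    obtain q where q: "\<forall>k<a. \<bar>q k\<bar> \<le> L * \<beta>"
      and orth: "\<And>k. k < a \<Longrightarrow> (\<Sum>l<b. (w l - (\<Sum>k'<a. q k' * p k' l)) * p k l) = 0"
      using proj[of \<beta> w] \<beta> by blast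
    define \<rho> where "\<rho> l = w l - (\<Sum>k<a. q k * p k l)" for l
    have "(\<Sum>l<b. (\<rho> l)\<^sup>2) = (\<Sum>l<b. \<rho> l * (\<Sum>k<a. (q0 k - q k) * p k l))"
      using w by (intro sum.cong refl)
        (auto simp: \<rho>_def power2_eq_square left_diff_distrib sum_subtractf)
    also have "\<dots> = (\<Sum>k<a. (q0 k - q k) * (\<Sum>l<b. \<rho> l * p k l))"
      unfolding sum_distrib_left by (subst sum.swap) (simp add: mult_ac)
    also have "\<dots> = 0" using orth by (simp add: \<rho>_def)
    finally have "\<forall>l<b. \<rho> l = 0" by (subst (asm) sum_nonneg_eq_0_iff) auto
    then have "\<forall>l<b. w l = (\<Sum>k<a. q k * p k l)" by (simp add: \<rho>_def)
    with q show "\<exists>q. (\<forall>k<a. \<bar>q k\<bar> \<le> L * \<beta>) \<and> (\<forall>l<b. w l = (\<Sum>k<a. q k * p k l))" by blast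
  qed
qed

lemma length_block_labels [simp]: "length (block_labels ms) = sum_list ms"
  by (simp add: block_labels_def length_concat comp_def map_nth)

lemma block_labels_nth_less:
  assumes "i < sum_list ms"
  shows "block_labels ms ! i < length ms"
proof -
  have "set (block_labels ms) \<subseteq> {..<length ms}" by (auto simp: block_labels_def)
  moreover have "block_labels ms ! i \<in> set (block_labels ms)" using assms by simp
  ultimately show ?thesis by (meson lessThan_iff subsetD)
qed

lemma card_block_labels:
  assumes "k < length ms"
  shows "card {i. i < sum_list ms \<and> block_labels ms ! i = k} = ms ! k"
proof -
  have "length (filter (\<lambda>x. x = k) (concat (map (\<lambda>k. replicate (ms ! k) k) [0..<N]))) = (if k < N then ms ! k else 0)" for N
    by (induction N) (auto simp: less_Suc_eq)
  from this[of "length ms"] show ?thesis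
    using assms by (simp add: block_labels_def[symmetric] length_filter_conv_card)
qed

text \<open>Block \<open>k\<close> has at least \<open>c * sum_list ms\<close> coordinates, all
  equal to \<open>g k\<close>, and their squares add up to at most \<open>1\<close>.\<close>

lemma blockwise_constant_bound:
  assumes x: "x \<in> carrier_vec (sum_list ms)" "x \<bullet> x = 1" and const: "\<And>i. i < sum_list ms \<Longrightarrow> x $ i = g (block_labels ms ! i)"
    and c: "0 < c" and growth: "\<And>k. k \<in> set ms \<Longrightarrow> c \<le> real k / real (sum_list ms)"
    and k: "k < length ms" and pos: "0 < sum_list ms"
  shows "\<bar>g k\<bar> \<le> 1 / sqrt (c * real (sum_list ms))"
proof -
  let ?m = "sum_list ms"
  let ?I = "{i. i < ?m \<and> block_labels ms ! i = k}"
  have "c * real ?m \<le> real (ms ! k)" using growth[of "ms ! k"] k pos by (simp add: field_simps)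
  then have "(c * real ?m) * (g k)\<^sup>2 \<le> real (card ?I) * (g k)\<^sup>2"
    by (intro mult_right_mono) (simp_all add: card_block_labels[OF k])
  also have "\<dots> = (\<Sum>i\<in>?I. (g k)\<^sup>2)" by simp
  also have "\<dots> = (\<Sum>i\<in>?I. (x $ i)\<^sup>2)" using const by (intro sum.cong) auto
  also have "\<dots> \<le> (\<Sum>i<?m. (x $ i)\<^sup>2)" by (intro sum_mono2) auto
  also have "\<dots> = 1" using scalar_prod_self[OF x(1)] x(2) by simp
  finally have "(g k)\<^sup>2 \<le> 1 / (c * real ?m)" using c pos by (simp add: field_simps)
  then have "sqrt ((g k)\<^sup>2) \<le> sqrt (1 / (c * real ?m))" by (rule real_sqrt_le_mono)
  then show ?thesis by (simp add: real_sqrt_divide)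
qed

text \<open>The singular vectors of a blown-up matrix are blockwise constant; writing \<open>u\<close> through the rows
  of the pattern with bounded coefficients and pairing with \<open>v\<close> gives \<open>1 \<le> s \<cdot> O(1 / sqrt (m n))\<close>.\<close>

lemma blown_up_singular_value_ge:
  assumes c: "0 < c" and d: "0 < d"
  shows "\<exists>\<kappa>>0. \<forall>ms ns s u v. block_sizes a (sum_list ms) ms \<and> block_sizes b (sum_list ns) ns \<and>
     growth_condition_1 c d ms ns \<and> 0 < sum_list ms \<and> 0 < sum_list ns \<and> 0 < s \<and>
     u \<in> carrier_vec (sum_list ns) \<and> v \<in> carrier_vec (sum_list ms) \<and> u \<bullet> u = 1 \<and> v \<bullet> v = 1 \<and>
     blown_up P ms ns *\<^sub>v u = s \<cdot>\<^sub>v v \<and> transpose_mat (blown_up P ms ns) *\<^sub>v v = s \<cdot>\<^sub>v u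
     \<longrightarrow> \<kappa> * sqrt (real (sum_list ms) * real (sum_list ns)) \<le> s"
proof -
  obtain L where L: "L \<ge> 0" and coeff: "\<And>w \<beta> q0. 0 \<le> \<beta> \<and> (\<forall>l<b. \<bar>w l\<bar> \<le> \<beta>) \<and>
      (\<forall>l<b. w l = (\<Sum>k<a. q0 k * P $$ (k, l))) \<Longrightarrow>
    \<exists>q. (\<forall>k<a. \<bar>q k\<bar> \<le> L * \<beta>) \<and> (\<forall>l<b. w l = (\<Sum>k<a. q k * P $$ (k, l)))"
    using bounded_row_space_coefficients[where a = a and b = b and p = "\<lambda>k l. P $$ (k, l)"] by blast
  \<comment> \<open>Read off from the final chain \<open>1 \<le> s * (real a * L) / (sqrt (c * d) *
    sqrt (real m * real n))\<close>; the added \<open>1\<close> keeps the denominator positive when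
    \<open>real a * L = 0\<close>.\<close>
  define \<kappa> where "\<kappa> = sqrt (c * d) / (real a * L + 1)"
  have den: "0 < real a * L + 1" using L by (simp add: add_nonneg_pos)
  have "\<kappa> > 0" using c d den by (simp add: \<kappa>_def)
  moreover have "\<kappa> * sqrt (real (sum_list ms) * real (sum_list ns)) \<le> s"
    if bs: "block_sizes a (sum_list ms) ms" "block_sizes b (sum_list ns) ns"
      and gc: "growth_condition_1 c d ms ns" and mpos: "0 < sum_list ms" and npos: "0 < sum_list ns"
      and s: "0 < s" and u: "u \<in> carrier_vec (sum_list ns)" and v: "v \<in> carrier_vec (sum_list ms)"
      and uu: "u \<bullet> u = 1" and vv: "v \<bullet> v = 1"
      and Bu: "blown_up P ms ns *\<^sub>v u = s \<cdot>\<^sub>v v" and Bv: "transpose_mat (blown_up P ms ns) *\<^sub>v v = s \<cdot>\<^sub>v u"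
    for ms ns s u v
  proof -
    define m where "m = sum_list ms"
    define n where "n = sum_list ns"
    let ?I = "\<lambda>i. block_labels ms ! i" and ?J = "\<lambda>j. block_labels ns ! j"
    have len: "length ms = a" "length ns = b" using bs by (auto simp: block_sizes_def)
    have lab: "?I i < a" if "i < m" for i using that block_labels_nth_less[of i ms] len by (simp add: m_def)
    have lab': "?J j < b" if "j < n" for j using that block_labels_nth_less[of j ns] len by (simp add: n_def)
    \<comment> \<open>The block values of \<open>v\<close> and \<open>u\<close>: dividing the two
      singular vector equations by \<open>s\<close> shows that an entry depends on its block label
      only.\<close>
    define g where "g k = (\<Sum>j<n. P $$ (k, ?J j) * u $ j) / s" for k
    define h where "h l = (\<Sum>i<m. P $$ (?I i, l) * v $ i) / s" for l
    have sg: "(\<Sum>j<n. P $$ (k, ?J j) * u $ j) = s * g k" for k using s by (simp add: g_def)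
    have vg: "v $ i = g (?I i)" if "i < m" for i
      using arg_cong[OF Bu, of "\<lambda>x. x $ i"] that u v s
      by (simp add: blown_up_def scalar_prod_def lessThan_atLeast0 g_def m_def n_def field_simps)
    have uh: "u $ j = h (?J j)" if "j < n" for j
      using arg_cong[OF Bv, of "\<lambda>x. x $ j"] that u v s
      by (simp add: blown_up_def scalar_prod_def lessThan_atLeast0 h_def m_def n_def field_simps)
    have g: "\<bar>g k\<bar> \<le> 1 / sqrt (c * real m)" if "k < a" for k
      unfolding m_def
      by (rule blockwise_constant_bound[OF v vv _ c _ _ mpos])
        (use that len vg gc in \<open>auto simp: m_def growth_condition_1_def\<close>)
    have h: "\<bar>h l\<bar> \<le> 1 / sqrt (d * real n)" if "l < b" for l
      unfolding n_def
      by (rule blockwise_constant_bound[OF u uu _ d _ _ npos])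
        (use that len uh gc in \<open>auto simp: n_def growth_condition_1_def\<close>)
    \<comment> \<open>\<open>q0\<close> shows that \<open>h\<close> lies in the row space of
      \<open>P\<close>. It contains a factor \<open>1 / s\<close>, so bounding it directly would be
      circular; \<open>coeff\<close> trades it for bounded coefficients.\<close>
    define q0 where "q0 k = (\<Sum>i\<in>{i. i < m \<and> ?I i = k}. v $ i) / s" for k
    have hq0: "h l = (\<Sum>k<a. q0 k * P $$ (k, l))" for l
    proof -
      have "(\<Sum>i<m. P $$ (?I i, l) * v $ i) = (\<Sum>k<a. \<Sum>i\<in>{i \<in> {..<m}. ?I i = k}. P $$ (?I i, l) * v $ i)"
        using lab by (intro sum.group[symmetric]) auto
      also have "\<dots> = (\<Sum>k<a. (\<Sum>i\<in>{i. i < m \<and> ?I i = k}. v $ i) * P $$ (k, l))"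
        unfolding sum_distrib_right by (intro sum.cong refl) (auto simp: mult.commute)
      finally show ?thesis by (simp add: h_def q0_def sum_divide_distrib[of _ "{..<a}"])
    qed
    have "0 \<le> 1 / sqrt (d * real n)" using d by simp
    with h hq0 obtain q where q: "\<And>k. k < a \<Longrightarrow> \<bar>q k\<bar> \<le> L * (1 / sqrt (d * real n))"
      and hq: "\<And>l. l < b \<Longrightarrow> h l = (\<Sum>k<a. q k * P $$ (k, l))"
      using coeff[of "1 / sqrt (d * real n)" h q0] by blast
    \<comment> \<open>One factor of \<open>u \<bullet> u\<close> is expanded through the rows of
      \<open>P\<close>; each row paired with the other factor returns
      \<open>s * g k\<close>.\<close>
    have "1 = (\<Sum>j<n. u $ j * u $ j)"
      using uu scalar_prod_self[OF u] by (simp add: n_def power2_eq_square)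
    also have "\<dots> = (\<Sum>j<n. \<Sum>k<a. q k * (P $$ (k, ?J j) * u $ j))"
      using uh hq lab' by (intro sum.cong refl) (simp add: sum_distrib_left mult_ac)
    also have "\<dots> = (\<Sum>k<a. q k * (\<Sum>j<n. P $$ (k, ?J j) * u $ j))"
      unfolding sum_distrib_left by (rule sum.swap)
    also have "\<dots> = s * (\<Sum>k<a. q k * g k)" unfolding sg by (simp add: sum_distrib_left mult_ac)
    also have "\<dots> \<le> s * (\<Sum>k<a. L * (1 / sqrt (d * real n)) * (1 / sqrt (c * real m)))"
    proof (intro mult_left_mono sum_mono)
      fix k assume "k \<in> {..<a}"
      then have k: "k < a" by simp
      have "q k * g k \<le> \<bar>q k\<bar> * \<bar>g k\<bar>" by (simp add: abs_mult[symmetric])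
      also have "\<dots> \<le> L * (1 / sqrt (d * real n)) * (1 / sqrt (c * real m))"
        using q[OF k] g[OF k] L d by (intro mult_mono) auto
      finally show "q k * g k \<le> L * (1 / sqrt (d * real n)) * (1 / sqrt (c * real m))" .
    qed (use s in simp)
    also have "\<dots> = s * (real a * L) / (sqrt (c * d) * sqrt (real m * real n))"
      by (simp add: real_sqrt_mult mult_ac)
    also have "\<dots> \<le> s * (real a * L + 1) / (sqrt (c * d) * sqrt (real m * real n))"
      using s c d by (intro divide_right_mono mult_left_mono) auto
    finally have "sqrt (c * d) * sqrt (real m * real n) \<le> s * (real a * L + 1)"
      using c d mpos npos by (simp add: m_def n_def field_simps)
    then show ?thesis using den by (simp add: \<kappa>_def m_def n_def field_simps)
  qed
  ultimately show ?thesis by blast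
qed

section \<open>Spectral norm of Wigner noise\<close>

text \<open>The radius \<open>2 * sqrt m\<close> is the room that rounding takes: an error of at
  most \<open>1\<close> per coordinate turns \<open>a\<^sup>2\<close> into at most
  \<open>2 * a\<^sup>2 + 2\<close>, which sums to \<open>4 * m\<close> when a vector of length at
  most \<open>1\<close> is scaled by \<open>sqrt m\<close>. \<open>extensional\<close> pins the
  values beyond \<open>m\<close>, so that the points can be counted.\<close>

definition lattice_ball :: "nat \<Rightarrow> (nat \<Rightarrow> int) set" where
  "lattice_ball m = {z \<in> extensional {..<m}. (\<Sum>i<m. (z i)\<^sup>2) \<le> 4 * int m}"

text \<open>The subtracted tail makes the induction close; the application keeps only the bound
  \<open>3\<close>.\<close>

lemma sum_half_power_abs_le: "(\<Sum>k\<in>{- int N..int N}. (1/2 :: real) ^ nat \<bar>k\<bar>) \<le> 3 - 2 * (1/2) ^ N"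
proof (induction N)
  case (Suc N)
  have "{- int (Suc N)..int (Suc N)} = insert (- int (Suc N)) (insert (int (Suc N)) {- int N..int N})" by auto
  then have "(\<Sum>k\<in>{- int (Suc N)..int (Suc N)}. (1/2 :: real) ^ nat \<bar>k\<bar>)
      = 2 * (1/2) ^ Suc N + (\<Sum>k\<in>{- int N..int N}. (1/2 :: real) ^ nat \<bar>k\<bar>)"
    by (simp add: nat_add_distrib)
  also have "\<dots> \<le> 2 * (1/2) ^ Suc N + (3 - 2 * (1/2) ^ N)" using Suc.IH by simp
  also have "\<dots> = 3 - 2 * (1/2) ^ Suc N" by simp
  finally show ?case .
qed simp

text \<open>Counting through the generating function: weight the lattice point \<open>z\<close> by \<open>2\<close> to the power \<open>-|z|\<^sub>1\<close>.\<close>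

lemma finite_lattice_ball: "finite (lattice_ball m)"
  and card_lattice_ball: "real (card (lattice_ball m)) \<le> 48 ^ m"
proof -
  \<comment> \<open>A finite box, on which the weighted sum factorises over coordinates. It contains
    the ball because \<open>\<bar>k\<bar> \<le> k\<^sup>2\<close> for integers bounds the sum of
    absolute values by \<open>4 * m\<close>.\<close>
  let ?Z = "{..<m} \<rightarrow>\<^sub>E {- int (4 * m)..int (4 * m)}"
  have abs_le: "\<bar>k\<bar> \<le> k\<^sup>2" for k :: int
    using self_le_power[of "\<bar>k\<bar>" 2] by (cases "k = 0") auto
  have l1: "(\<Sum>i<m. \<bar>z i\<bar>) \<le> 4 * int m" if "z \<in> lattice_ball m" for z
  proof -
    have "(\<Sum>i<m. \<bar>z i\<bar>) \<le> (\<Sum>i<m. (z i)\<^sup>2)" by (intro sum_mono abs_le)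
    then show ?thesis using that by (simp add: lattice_ball_def)
  qed
  have sub: "lattice_ball m \<subseteq> ?Z"
  proof
    fix z assume z: "z \<in> lattice_ball m"
    have "z i \<in> {- int (4 * m)..int (4 * m)}" if "i < m" for i
    proof -
      have "\<bar>z i\<bar> \<le> 4 * int m"
        using l1[OF z] member_le_sum[of i "{..<m}" "\<lambda>i. \<bar>z i\<bar>"] that by simp
      then show ?thesis by (auto simp: abs_le_iff)
    qed
    then show "z \<in> ?Z" using z unfolding lattice_ball_def PiE_def Pi_def by blast
  qed
  have finZ: "finite ?Z" by (intro finite_PiE) auto
  show fin: "finite (lattice_ball m)" by (rule finite_subset[OF sub finZ])
  have weight: "(1/2 :: real) ^ (4 * m) \<le> (\<Prod>i<m. (1/2) ^ nat \<bar>z i\<bar>)" if z: "z \<in> lattice_ball m" for z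
  proof -
    have "int (\<Sum>i<m. nat \<bar>z i\<bar>) \<le> int (4 * m)" using l1[OF z] by simp
    then have "(\<Sum>i<m. nat \<bar>z i\<bar>) \<le> 4 * m" by (simp only: of_nat_le_iff)
    then have "(1/2 :: real) ^ (4 * m) \<le> (1/2) ^ (\<Sum>i<m. nat \<bar>z i\<bar>)" by (intro power_decreasing) auto
    also have "\<dots> = (\<Prod>i<m. (1/2) ^ nat \<bar>z i\<bar>)" by (simp add: power_sum)
    finally show ?thesis .
  qed
  \<comment> \<open>Each point of the ball weighs at least \<open>(1/2) ^ (4 * m)\<close> and the
    whole box at most \<open>3 ^ m\<close>; the quotient is \<open>(3 * 16) ^ m\<close>.\<close>
  have "real (card (lattice_ball m)) * (1/2) ^ (4 * m) = (\<Sum>z\<in>lattice_ball m. (1/2) ^ (4 * m))" by simp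
  also have "\<dots> \<le> (\<Sum>z\<in>lattice_ball m. \<Prod>i<m. (1/2) ^ nat \<bar>z i\<bar>)" by (intro sum_mono weight)
  also have "\<dots> \<le> (\<Sum>z\<in>?Z. \<Prod>i<m. (1/2) ^ nat \<bar>z i\<bar>)"
    by (intro sum_mono2 finZ sub prod_nonneg) auto
  also have "\<dots> = (\<Prod>i<m. \<Sum>k\<in>{- int (4 * m)..int (4 * m)}. (1/2) ^ nat \<bar>k\<bar>)"
    by (rule prod_sum_PiE[symmetric]) auto
  also have "\<dots> \<le> (\<Prod>i<m. 3)"
  proof (intro prod_mono conjI)
    show "(\<Sum>k\<in>{- int (4 * m)..int (4 * m)}. (1/2 :: real) ^ nat \<bar>k\<bar>) \<le> 3"
      by (rule order_trans[OF sum_half_power_abs_le]) simp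
  qed (intro sum_nonneg, simp)
  also have "\<dots> = 3 ^ m" by simp
  finally have *: "real (card (lattice_ball m)) * (1/2) ^ (4 * m) \<le> 3 ^ m" .
  have "(1/2 :: real) ^ (4 * m) * 16 ^ m = (((1/2) ^ 4) * 16) ^ m"
    by (simp only: power_mult power_mult_distrib)
  also have "\<dots> = 1" by (simp add: power_divide)
  finally have "(1/2 :: real) ^ (4 * m) * 16 ^ m = 1" .
  then have "real (card (lattice_ball m)) = (real (card (lattice_ball m)) * (1/2) ^ (4 * m)) * 16 ^ m"
    by (simp only: mult.assoc mult_1_right)
  also have "\<dots> \<le> 3 ^ m * 16 ^ m" using * by (intro mult_right_mono) auto
  also have "\<dots> = (3 * 16) ^ m" by (simp only: power_mult_distrib)
  also have "\<dots> = 48 ^ m" by simp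
  finally show "real (card (lattice_ball m)) \<le> 48 ^ m" .
qed

text \<open>Rounding each coordinate up or down by the sign of its coefficient never decreases the linear form,
  so no approximation factor is lost.\<close>

lemma round_to_lattice_ball:
  fixes c x :: "nat \<Rightarrow> real"
  assumes x: "(\<Sum>i<m. (x i)\<^sup>2) \<le> 1"
  shows "\<exists>z\<in>lattice_ball m. sqrt m * (\<Sum>i<m. c i * x i) \<le> (\<Sum>i<m. c i * of_int (z i))"
proof -
  let ?s = "sqrt (real m)"
  define z where "z i = (if i < m then if c i \<ge> 0 then \<lceil>?s * x i\<rceil> else \<lfloor>?s * x i\<rfloor> else undefined)" for i
  have sq: "(of_int (z i))\<^sup>2 \<le> 2 * (real m * (x i)\<^sup>2) + 2" if i: "i < m" for i
  proof -
    define \<delta> where "\<delta> = of_int (z i) - ?s * x i"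
    have "\<bar>\<delta>\<bar> \<le> 1" using i unfolding \<delta>_def z_def by (simp; linarith)
    then have "\<delta>\<^sup>2 \<le> 1" by (simp add: abs_square_le_1)
    moreover have "(?s * x i + \<delta>)\<^sup>2 \<le> 2 * (?s * x i)\<^sup>2 + 2 * \<delta>\<^sup>2"
      using zero_le_power2[of "?s * x i - \<delta>"] by (simp add: power2_eq_square algebra_simps)
    ultimately show ?thesis by (simp add: \<delta>_def power_mult_distrib)
  qed
  have "real_of_int (\<Sum>i<m. (z i)\<^sup>2) = (\<Sum>i<m. (of_int (z i))\<^sup>2)" by simp
  also have "\<dots> \<le> (\<Sum>i<m. 2 * (real m * (x i)\<^sup>2) + 2)" using sq by (intro sum_mono) auto
  also have "\<dots> = 2 * real m * (\<Sum>i<m. (x i)\<^sup>2) + 2 * real m"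
    by (simp add: sum.distrib sum_distrib_left mult.assoc)
  also have "\<dots> \<le> 2 * real m * 1 + 2 * real m" using x by (intro add_mono mult_left_mono) auto
  also have "\<dots> = real_of_int (4 * int m)" by simp
  finally have "(\<Sum>i<m. (z i)\<^sup>2) \<le> 4 * int m" by (simp only: of_int_le_iff)
  then have "z \<in> lattice_ball m" by (auto simp: lattice_ball_def z_def extensional_def)
  moreover have "?s * (\<Sum>i<m. c i * x i) \<le> (\<Sum>i<m. c i * of_int (z i))"
    unfolding sum_distrib_left
  proof (rule sum_mono)
    fix i assume i: "i \<in> {..<m}"
    have "c i * (?s * x i) \<le> c i * of_int (z i)"
    proof (cases "c i \<ge> 0")
      case True
      then show ?thesis using i by (intro mult_left_mono) (auto simp: z_def)
    next
      case False
      then show ?thesis using i by (intro mult_left_mono_neg) (auto simp: z_def)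
    qed
    then show "?s * (c i * x i) \<le> c i * of_int (z i)" by (simp add: mult_ac)
  qed
  ultimately show ?thesis by blast
qed

text \<open>The form is linear in each argument: \<open>x\<close> is rounded against the
  coefficients produced by \<open>y\<close>, then \<open>y\<close> against those produced by the
  lattice point \<open>z\<close> just found. The scalings \<open>sqrt m\<close> and
  \<open>sqrt n\<close> cancel with those in the hypothesis.\<close>

lemma bilinear_form_le_if_lattice:
  fixes A :: "nat \<Rightarrow> nat \<Rightarrow> real"
  assumes lat: "\<And>z w. z \<in> lattice_ball m \<Longrightarrow> w \<in> lattice_ball n \<Longrightarrow>
      (\<Sum>i<m. \<Sum>j<n. of_int (z i) * of_int (w j) * A i j) \<le> T * (sqrt m * sqrt n)"
    and x: "(\<Sum>i<m. (x i)\<^sup>2) \<le> 1" and y: "(\<Sum>j<n. (y j)\<^sup>2) \<le> 1" and mn: "m > 0" "n > 0"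
  shows "(\<Sum>i<m. \<Sum>j<n. x i * A i j * y j) \<le> T"
proof -
  obtain z where z: "z \<in> lattice_ball m" and
    "sqrt m * (\<Sum>i<m. (\<Sum>j<n. A i j * y j) * x i) \<le> (\<Sum>i<m. (\<Sum>j<n. A i j * y j) * of_int (z i))"
    using round_to_lattice_ball[OF x, of "\<lambda>i. \<Sum>j<n. A i j * y j"] by blast
  moreover have "(\<Sum>i<m. (\<Sum>j<n. A i j * y j) * of_int (z i)) = (\<Sum>j<n. (\<Sum>i<m. A i j * of_int (z i)) * y j)"
    unfolding sum_distrib_right by (subst sum.swap) (simp add: mult_ac)
  moreover obtain w where w: "w \<in> lattice_ball n" and
    "sqrt n * (\<Sum>j<n. (\<Sum>i<m. A i j * of_int (z i)) * y j) \<le> (\<Sum>j<n. (\<Sum>i<m. A i j * of_int (z i)) * of_int (w j))"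
    using round_to_lattice_ball[OF y, of "\<lambda>j. \<Sum>i<m. A i j * of_int (z i)"] by blast
  moreover have "(\<Sum>j<n. (\<Sum>i<m. A i j * of_int (z i)) * of_int (w j))
      = (\<Sum>i<m. \<Sum>j<n. of_int (z i) * of_int (w j) * A i j)"
    unfolding sum_distrib_right by (subst sum.swap) (simp add: mult_ac)
  moreover have "(\<Sum>i<m. (\<Sum>j<n. A i j * y j) * x i) = (\<Sum>i<m. \<Sum>j<n. x i * A i j * y j)"
    unfolding sum_distrib_right by (simp add: mult_ac)
  ultimately have *: "sqrt m * (\<Sum>i<m. \<Sum>j<n. x i * A i j * y j) \<le> (\<Sum>j<n. (\<Sum>i<m. A i j * of_int (z i)) * y j)"
    and "sqrt n * (\<Sum>j<n. (\<Sum>i<m. A i j * of_int (z i)) * y j) \<le> T * (sqrt m * sqrt n)"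
    using lat[OF z w] by simp_all
  then have "sqrt n * (sqrt m * (\<Sum>i<m. \<Sum>j<n. x i * A i j * y j)) \<le> T * (sqrt m * sqrt n)"
    by (meson mult_left_mono order_trans real_sqrt_ge_zero of_nat_0_le_iff)
  then have "(\<Sum>i<m. \<Sum>j<n. x i * A i j * y j) * (sqrt m * sqrt n) \<le> T * (sqrt m * sqrt n)"
    by (simp add: mult_ac)
  then show ?thesis using mn by (simp add: mult_le_cancel_right_pos)
qed

lemma wigner_noise_entry_measurable:
  assumes "prob_space M" "wigner_noise M K m n W" "i < m" "j < n"
  shows "(\<lambda>\<omega>. W \<omega> $$ (i, j)) \<in> borel_measurable M"
  using assms unfolding wigner_noise_def prob_space.indep_vars_def[OF assms(1)] by auto

text \<open>The terms lie in intervals of length \<open>2 * K * \<bar>c ij\<bar>\<close>. The sum of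
  \<open>(c ij)\<^sup>2\<close> factorises into the squared lengths of \<open>z\<close> and
  \<open>w\<close>, at most \<open>16 * m * n\<close> together, so the squared interval lengths
  total at most \<open>64 * K\<^sup>2 * m * n\<close>; Hoeffding's factor \<open>2\<close> turns
  \<open>64\<close> into \<open>32\<close>.\<close>

lemma wigner_noise_lattice_tail:
  assumes M: "prob_space M" and W: "wigner_noise M K m n W" and K: "0 < K"
    and z: "z \<in> lattice_ball m" and w: "w \<in> lattice_ball n" and t: "0 < t"
  defines "S \<equiv> (\<lambda>\<omega>. \<Sum>i<m. \<Sum>j<n. of_int (z i) * of_int (w j) * W \<omega> $$ (i, j))"
  shows "measure M {\<omega> \<in> space M. t \<le> S \<omega>} \<le> exp (- t\<^sup>2 / (32 * K\<^sup>2 * (real m * real n)))"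
proof -
  interpret prob_space M by fact
  define c where "c = (\<lambda>ij :: nat \<times> nat. real_of_int (z (fst ij)) * real_of_int (w (snd ij)))"
  let ?I = "{..<m} \<times> {..<n}"
  have S: "S \<omega> = (\<Sum>ij\<in>?I. c ij * W \<omega> $$ ij)" for \<omega>
    by (simp add: S_def c_def sum.cartesian_product case_prod_beta)
  have sq: "(\<Sum>i<k. (real_of_int (v i))\<^sup>2) \<le> 4 * real k" if "v \<in> lattice_ball k" for v k
  proof -
    have "real_of_int (\<Sum>i<k. (v i)\<^sup>2) \<le> real_of_int (4 * int k)"
      using that by (simp only: of_int_le_iff) (simp add: lattice_ball_def)
    then show ?thesis by simp
  qed
  have c2: "(\<Sum>ij\<in>?I. (c ij)\<^sup>2) = (\<Sum>i<m. (real_of_int (z i))\<^sup>2) * (\<Sum>j<n. (real_of_int (w j))\<^sup>2)"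
    unfolding sum_product by (simp add: c_def sum.cartesian_product case_prod_beta power_mult_distrib)
  also have "\<dots> \<le> (4 * real m) * (4 * real n)" by (intro mult_mono sq z w sum_nonneg) auto
  finally have c2_le: "(\<Sum>ij\<in>?I. (c ij)\<^sup>2) \<le> 16 * (real m * real n)" by simp
  have ranges: "(\<Sum>ij\<in>?I. (K * \<bar>c ij\<bar> - (- (K * \<bar>c ij\<bar>)))\<^sup>2) = 4 * K\<^sup>2 * (\<Sum>ij\<in>?I. (c ij)\<^sup>2)"
    by (simp add: sum_distrib_left power_mult_distrib mult.assoc)
  show ?thesis
  \<comment> \<open>Hoeffding's bound divides by this sum. If it vanishes, \<open>S\<close> is
    identically \<open>0\<close> and the event is empty since \<open>0 < t\<close>.\<close>
  proof (cases "(\<Sum>ij\<in>?I. (c ij)\<^sup>2) = 0")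
    case True
    then have "\<forall>ij\<in>?I. c ij = 0" by (subst (asm) sum_nonneg_eq_0_iff) auto
    then have "S \<omega> = 0" for \<omega> unfolding S by (intro sum.neutral) simp
    then have "{\<omega> \<in> space M. t \<le> S \<omega>} = {}" using t by auto
    then show ?thesis by (simp only: measure_empty) simp
  next
    case False
    then have c2_pos: "0 < (\<Sum>ij\<in>?I. (c ij)\<^sup>2)" by (simp add: sum_nonneg less_le)
    have indep: "indep_vars (\<lambda>_. borel) (\<lambda>ij \<omega>. c ij * W \<omega> $$ ij) ?I"
    proof (rule indep_vars_compose2[where Y = "\<lambda>ij x. c ij * x" and M' = "\<lambda>_. borel"])
      show "indep_vars (\<lambda>_. borel) (\<lambda>ij \<omega>. W \<omega> $$ ij) ?I" using W unfolding wigner_noise_def by blast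
    qed simp
    have bnd: "AE \<omega> in M. \<bar>W \<omega> $$ ij\<bar> \<le> K" and mean: "expectation (\<lambda>\<omega>. W \<omega> $$ ij) = 0" if "ij \<in> ?I" for ij
      using W that unfolding wigner_noise_def by (cases ij; force)+
    interpret Hoeffding_ineq M ?I "\<lambda>ij \<omega>. c ij * W \<omega> $$ ij" "\<lambda>ij. - (K * \<bar>c ij\<bar>)" "\<lambda>ij. K * \<bar>c ij\<bar>" 0
    proof unfold_locales
      show "AE \<omega> in M. c ij * W \<omega> $$ ij \<in> {- (K * \<bar>c ij\<bar>)..K * \<bar>c ij\<bar>}" if "ij \<in> ?I" for ij
        using bnd[OF that]
      proof eventually_elim
        case (elim \<omega>)
        then have "\<bar>c ij * W \<omega> $$ ij\<bar> \<le> K * \<bar>c ij\<bar>" unfolding abs_mult by (subst mult.commute) (rule mult_right_mono, auto)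
        then show ?case by auto
      qed
      show "0 \<equiv> \<Sum>ij\<in>?I. expectation (\<lambda>\<omega>. c ij * W \<omega> $$ ij)"
        by (rule eq_reflection) (simp add: mean)
    qed (use indep in auto)
    have "prob {\<omega> \<in> space M. t \<le> S \<omega>}
        \<le> exp (- 2 * t\<^sup>2 / (\<Sum>ij\<in>?I. (K * \<bar>c ij\<bar> - (- (K * \<bar>c ij\<bar>)))\<^sup>2))"
      unfolding S using Hoeffding_ineq_ge[of t] t c2_pos K unfolding ranges by simp
    also have "\<dots> \<le> exp (- t\<^sup>2 / (32 * K\<^sup>2 * (real m * real n)))"
    proof -
      have "0 < real m * real n" using c2_le c2_pos by linarith
      then have mn: "0 < m" "0 < n" by (auto simp: zero_less_mult_iff)
      have "4 * K\<^sup>2 * (\<Sum>ij\<in>?I. (c ij)\<^sup>2) \<le> 4 * K\<^sup>2 * (16 * (real m * real n))"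
        using c2_le by (intro mult_left_mono) auto
      then have "2 * t\<^sup>2 / (4 * K\<^sup>2 * (16 * (real m * real n))) \<le> 2 * t\<^sup>2 / (4 * K\<^sup>2 * (\<Sum>ij\<in>?I. (c ij)\<^sup>2))"
        using c2_pos K t mn by (intro divide_left_mono mult_pos_pos) auto
      moreover have "2 * t\<^sup>2 / (4 * K\<^sup>2 * (16 * (real m * real n))) = t\<^sup>2 / (32 * K\<^sup>2 * (real m * real n))"
        by simp
      ultimately have "t\<^sup>2 / (32 * K\<^sup>2 * (real m * real n)) \<le> 2 * t\<^sup>2 / (4 * K\<^sup>2 * (\<Sum>ij\<in>?I. (c ij)\<^sup>2))"
        by (simp only:)
      then show ?thesis unfolding ranges
        by (simp only: exp_le_cancel_iff mult_minus_left minus_divide_left[symmetric] neg_le_iff_le)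
    qed
    finally show ?thesis .
  qed
qed

text \<open>The vectors are quantified inside the almost sure statement. This is possible because
  the lattices reduce each size to finitely many events, so that one null set serves all
  \<open>x\<close> and \<open>y\<close>.\<close>

lemma wigner_noise_bilinear_bound:
  assumes M: "prob_space M" and K: "0 < K" and W: "\<And>m n. wigner_noise M K m n (W m n)"
  shows "\<exists>\<tau>>0. AE \<omega> in M. \<exists>k0. \<forall>m n x y. 0 < m \<and> 0 < n \<and> k0 \<le> m + n \<and>
    (\<Sum>i<m. (x i)\<^sup>2) \<le> 1 \<and> (\<Sum>j<n. (y j)\<^sup>2) \<le> 1 \<longrightarrow>
    (\<Sum>i<m. \<Sum>j<n. x i * W m n \<omega> $$ (i, j) * y j) \<le> \<tau> * sqrt (real (m + n))"
proof -
  interpret prob_space M by fact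
  \<comment> \<open>\<open>192 = 4 * 48\<close>: each tail is then at most
    \<open>(1/192) ^ (m + n)\<close>, and the union over at most \<open>48 ^ (m + n)\<close> lattice
    pairs leaves \<open>(1/4) ^ (m + n)\<close>.\<close>
  define \<tau> where "\<tau> = sqrt (32 * K\<^sup>2 * ln 192)"
  have \<tau>: "0 < \<tau>" and \<tau>2: "\<tau>\<^sup>2 = 32 * K\<^sup>2 * ln 192" using K by (simp_all add: \<tau>_def)
  define t where "t m n = \<tau> * sqrt (real (m + n)) * (sqrt (real m) * sqrt (real n))" for m n :: nat
  define S where "S m n z w \<omega> = (\<Sum>i<m. \<Sum>j<n. of_int (z i) * of_int (w j) * W m n \<omega> $$ (i, j))"
    for m n and z w :: "nat \<Rightarrow> int" and \<omega>
  define bad where "bad m n = (\<Union>z\<in>lattice_ball m. \<Union>w\<in>lattice_ball n. {\<omega> \<in> space M. t m n \<le> S m n z w \<omega>})" for m n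
  \<comment> \<open>All shapes with positive \<open>m\<close>, \<open>n\<close> and
    \<open>m + n = k\<close>. There are \<open>k - 1 \<le> 2 ^ k\<close> of them, which still leaves
    the summable bound \<open>(1/2) ^ k\<close>.\<close>
  define E where "E k = (\<Union>m\<in>{1..<k}. bad m (k - m))" for k
  have meas1: "{\<omega> \<in> space M. t m n \<le> S m n z w \<omega>} \<in> sets M" for m n z w
  proof -
    have "S m n z w \<in> borel_measurable M" unfolding S_def
      by (intro borel_measurable_sum borel_measurable_times borel_measurable_const
          wigner_noise_entry_measurable[OF M W]) auto
    then show ?thesis by measurable
  qed
  have meas2: "bad m n \<in> sets M" for m n unfolding bad_def
    by (intro sets.finite_UN finite_lattice_ball meas1)
  have meas3: "E k \<in> sets M" for k unfolding E_def by (intro sets.finite_UN meas2) auto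
  have bad_prob: "prob (bad m n) \<le> (1/4) ^ (m + n)" if mn: "0 < m" "0 < n" for m n
  proof -
    have t_pos: "0 < t m n" using \<tau> mn by (simp add: t_def)
    have "(t m n)\<^sup>2 = \<tau>\<^sup>2 * real (m + n) * (real m * real n)"
      by (simp add: t_def power_mult_distrib)
    then have "(t m n)\<^sup>2 / (32 * K\<^sup>2 * (real m * real n)) = real (m + n) * ln 192"
      using K mn by (simp add: \<tau>2)
    then have ex: "exp (- (t m n)\<^sup>2 / (32 * K\<^sup>2 * (real m * real n))) = (1/192) ^ (m + n)"
      by (simp add: exp_minus exp_of_nat_mult power_one_over inverse_eq_divide del: of_nat_add)
    have one: "prob {\<omega> \<in> space M. t m n \<le> S m n z w \<omega>} \<le> (1/192) ^ (m + n)"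
      if "z \<in> lattice_ball m" "w \<in> lattice_ball n" for z w
      using wigner_noise_lattice_tail[OF M W K that t_pos] unfolding ex S_def .
    have "prob (bad m n) \<le> (\<Sum>z\<in>lattice_ball m. prob (\<Union>w\<in>lattice_ball n. {\<omega> \<in> space M. t m n \<le> S m n z w \<omega>}))"
      unfolding bad_def by (intro finite_measure_subadditive_finite finite_lattice_ball)
        (auto intro!: sets.finite_UN finite_lattice_ball meas1)
    also have "\<dots> \<le> (\<Sum>z\<in>lattice_ball m. \<Sum>w\<in>lattice_ball n. prob {\<omega> \<in> space M. t m n \<le> S m n z w \<omega>})"
      by (intro sum_mono finite_measure_subadditive_finite finite_lattice_ball) (auto intro!: meas1)
    also have "\<dots> \<le> (\<Sum>z\<in>lattice_ball m. \<Sum>w\<in>lattice_ball n. (1/192) ^ (m + n))"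
      by (intro sum_mono one)
    also have "\<dots> = real (card (lattice_ball m)) * real (card (lattice_ball n)) * (1/192) ^ (m + n)" by simp
    also have "\<dots> \<le> 48 ^ m * 48 ^ n * (1/192) ^ (m + n)"
      by (intro mult_right_mono mult_mono card_lattice_ball) auto
    also have "\<dots> = (48 * (1/192)) ^ (m + n)" by (simp only: power_mult_distrib power_add mult_ac)
    finally show ?thesis by simp
  qed
  have E_prob: "prob (E k) \<le> (1/2) ^ k" for k
  proof -
    have "prob (E k) \<le> (\<Sum>m\<in>{1..<k}. prob (bad m (k - m)))"
      unfolding E_def by (intro finite_measure_subadditive_finite) (auto simp: meas2)
    also have "\<dots> \<le> (\<Sum>m\<in>{1..<k}. (1/4) ^ k)"
    proof (intro sum_mono)
      fix m assume "m \<in> {1..<k}"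
      then show "prob (bad m (k - m)) \<le> (1/4) ^ k" using bad_prob[of m "k - m"] by auto
    qed
    also have "\<dots> = real (k - 1) * (1/4) ^ k" by simp
    also have "\<dots> \<le> 2 ^ k * (1/4) ^ k"
      by (intro mult_right_mono order_trans[OF _ less_imp_le[OF of_nat_less_two_power]]) auto
    also have "\<dots> = (2 * (1/4)) ^ k" by (simp only: power_mult_distrib)
    finally show ?thesis by simp
  qed
  have "summable (\<lambda>k. prob (E k))"
    by (rule summable_comparison_test'[OF summable_geometric[of "1/2 :: real"], of 0]) (use E_prob in auto)
  then have "AE \<omega> in M. eventually (\<lambda>k. \<omega> \<in> space M - E k) sequentially"
    by (intro borel_cantelli_AE1 meas3) (auto simp: emeasure_eq_measure)
  then have "AE \<omega> in M. \<exists>k0. \<forall>m n x y. 0 < m \<and> 0 < n \<and> k0 \<le> m + n \<and>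
    (\<Sum>i<m. (x i)\<^sup>2) \<le> 1 \<and> (\<Sum>j<n. (y j)\<^sup>2) \<le> 1 \<longrightarrow>
    (\<Sum>i<m. \<Sum>j<n. x i * W m n \<omega> $$ (i, j) * y j) \<le> \<tau> * sqrt (real (m + n))"
  proof eventually_elim
    case (elim \<omega>)
    then obtain k0 where k0: "\<And>k. k0 \<le> k \<Longrightarrow> \<omega> \<in> space M - E k"
      by (auto simp: eventually_sequentially)
    show ?case
    proof (intro exI[of _ k0] allI impI, elim conjE)
      fix m n :: nat and x y :: "nat \<Rightarrow> real"
      assume mn: "0 < m" "0 < n" "k0 \<le> m + n" and xy: "(\<Sum>i<m. (x i)\<^sup>2) \<le> 1" "(\<Sum>j<n. (y j)\<^sup>2) \<le> 1"
      have "\<omega> \<in> space M" "\<omega> \<notin> E (m + n)" using k0[OF mn(3)] by auto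
      moreover have "bad m n \<subseteq> E (m + n)" unfolding E_def using mn by (intro UN_upper[of m, THEN order_trans[rotated]]) auto
      ultimately have "\<omega> \<in> space M" "\<omega> \<notin> bad m n" by auto
      then have "S m n z w \<omega> \<le> t m n" if "z \<in> lattice_ball m" "w \<in> lattice_ball n" for z w
        using that unfolding bad_def by force
      then show "(\<Sum>i<m. \<Sum>j<n. x i * W m n \<omega> $$ (i, j) * y j) \<le> \<tau> * sqrt (real (m + n))"
        by (intro bilinear_form_le_if_lattice[OF _ xy mn(1,2)]) (simp add: S_def t_def)
    qed
  qed
  with \<tau> show ?thesis by blast
qed

section \<open>Perturbation of singular subspaces\<close>

lemma vec_norm2_mult_le_if_bilinear:
  fixes W :: "real mat"
  assumes W: "W \<in> carrier_mat m n"
    and bil: "\<And>x y. (\<Sum>i<m. (x i)\<^sup>2) \<le> 1 \<Longrightarrow> (\<Sum>j<n. (y j)\<^sup>2) \<le> 1 \<Longrightarrow>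
      (\<Sum>i<m. \<Sum>j<n. x i * W $$ (i, j) * y j) \<le> T"
    and x: "x \<in> carrier_vec n" "vec_norm2 x \<le> 1"
  shows "vec_norm2 (W *\<^sub>v x) \<le> T"
proof -
  have Wx: "W *\<^sub>v x \<in> carrier_vec m" using W x by auto
  define N where "N = vec_norm2 (W *\<^sub>v x)"
  \<comment> \<open>The normalised image, at which the form attains the norm. For
    \<open>N = 0\<close> the division yields \<open>0\<close>, and the steps below remain valid with
    that value.\<close>
  define y where "y i = (W *\<^sub>v x) $ i / N" for i
  have N: "0 \<le> N" by (simp add: N_def vec_norm2_nonneg)
  have N2: "N * N = (\<Sum>i<m. ((W *\<^sub>v x) $ i)\<^sup>2)"
    using vec_norm2_power2[of "W *\<^sub>v x"] scalar_prod_self[OF Wx] by (simp add: N_def power2_eq_square)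
  have "(\<Sum>i<m. (y i)\<^sup>2) = (\<Sum>i<m. ((W *\<^sub>v x) $ i)\<^sup>2) / (N * N)"
    unfolding y_def power_divide sum_divide_distrib by (simp only: power2_eq_square[of N])
  then have y1: "(\<Sum>i<m. (y i)\<^sup>2) \<le> 1" unfolding N2[symmetric] by simp
  have "(vec_norm2 x)\<^sup>2 \<le> 1" using x(2) vec_norm2_nonneg[of x] by (simp add: power_le_one)
  then have x1: "(\<Sum>j<n. (x $ j)\<^sup>2) \<le> 1" by (simp add: vec_norm2_power2 scalar_prod_self[OF x(1)])
  have "(\<Sum>i<m. \<Sum>j<n. y i * W $$ (i, j) * x $ j) = (\<Sum>i<m. y i * (W *\<^sub>v x) $ i)"
    using W x(1) by (intro sum.cong refl) (simp add: scalar_prod_def lessThan_atLeast0 sum_distrib_left mult.assoc)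
  also have "\<dots> = (\<Sum>i<m. ((W *\<^sub>v x) $ i)\<^sup>2) / N"
    unfolding sum_divide_distrib y_def by (intro sum.cong refl) (simp only: power2_eq_square times_divide_eq_left)
  also have "\<dots> = N" unfolding N2[symmetric] by simp
  finally show ?thesis using bil[OF y1 x1] by (simp add: N_def)
qed

text \<open>The deterministic part, for one fixed outcome. Each of the \<open>r\<close> indices is
  estimated by the same quotient, which is where the factor \<open>r\<close> comes from.\<close>

lemma singular_subspace_perturbation:
  assumes B: "B \<in> carrier_mat m n" and W: "W \<in> carrier_mat m n"
    and s: "filter (\<lambda>t. 0 < t) (singular_values B) = map s [0..<r]"
    and Bt: "singular_triples B r s v u"
    and z: "\<forall>i<r. z i = singular_values (B + W) ! i"
    and At: "singular_triples (B + W) r z y x"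
    and T: "\<And>x. x \<in> carrier_vec n \<Longrightarrow> vec_norm2 x \<le> 1 \<Longrightarrow> vec_norm2 (W *\<^sub>v x) \<le> T"
    and \<Delta>: "\<And>i. i < r \<Longrightarrow> \<Delta> \<le> s i" and gap: "spectral_norm W < \<Delta>"
  shows "(\<Sum>i<r. (dist_subspace (y i) (vec_span m (v ` {..<r})))\<^sup>2)
      \<le> real r * ((spectral_norm W)\<^sup>2 / (\<Delta> - spectral_norm W)\<^sup>2)"
    and "(\<Sum>i<r. (dist_subspace (x i) (vec_span n (u ` {..<r})))\<^sup>2)
      \<le> real r * ((spectral_norm W)\<^sup>2 / (\<Delta> - spectral_norm W)\<^sup>2)"
proof -
  define \<epsilon> where "\<epsilon> = spectral_norm W"
  define \<theta> where "\<theta> = \<Delta> - \<epsilon>"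
  let ?U = "family_mat n r u" and ?V = "family_mat m r v" and ?S = "mat_diag r s"
  note norms = spectral_norm_le[OF W T, folded \<epsilon>_def]
  have \<theta>: "0 < \<theta>" using gap by (simp add: \<theta>_def \<epsilon>_def)
  have \<epsilon>: "0 \<le> \<epsilon>" by (rule norms(4))
  have A: "B + W \<in> carrier_mat m n" using B W by simp
  have u: "orthonormal_family n r u" and v: "orthonormal_family m r v"
    using Bt B by (auto simp: singular_triples_def)
  have x: "orthonormal_family n r x" and y: "orthonormal_family m r y"
    and Ax: "\<And>i. i < r \<Longrightarrow> (B + W) *\<^sub>v x i = z i \<cdot>\<^sub>v y i"
    and Ay: "\<And>i. i < r \<Longrightarrow> transpose_mat (B + W) *\<^sub>v y i = z i \<cdot>\<^sub>v x i"
    using At A by (auto simp: singular_triples_def)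
  have xc: "x i \<in> carrier_vec n" "vec_norm2 (x i) = 1"
    and yc: "y i \<in> carrier_vec m" "vec_norm2 (y i) = 1"
    and uc: "u i \<in> carrier_vec n" and vc: "v i \<in> carrier_vec m" if "i < r" for i
    using x y u v that by (auto simp: orthonormal_family_def vec_norm2_def)
  have BU: "B * ?U = ?V * ?S" by (rule singular_triples_mat(1)[OF B Bt])
  have svd: "B = ?V * ?S * transpose_mat ?U" by (rule singular_value_decomposition[OF B s Bt])
  have S: "?S \<in> carrier_mat r r" by simp
  have VS: "?V * ?S \<in> carrier_mat m r" and US: "?U * ?S \<in> carrier_mat n r"
    by (rule mult_carrier_mat[OF family_mat_carrier S])+
  have ST: "transpose_mat ?S = ?S" by (rule eq_matI) (auto simp: mat_diag_def)
  \<comment> \<open>The transposed decomposition puts the range of \<open>transpose_mat B\<close>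
    into the span of \<open>u\<close>, as \<open>svd\<close> puts the range of \<open>B\<close> into
    the span of \<open>v\<close>.\<close>
  have svdT: "transpose_mat B = ?U * ?S * transpose_mat ?V"
  proof -
    have "transpose_mat B = transpose_mat (?V * ?S * transpose_mat ?U)" using svd by (rule arg_cong)
    also have "\<dots> = ?U * transpose_mat (?V * ?S)"
      using transpose_mult[OF VS, of "transpose_mat ?U" n] by simp
    also have "transpose_mat (?V * ?S) = ?S * transpose_mat ?V"
      using transpose_mult[of ?V m r ?S r] by (simp add: ST)
    also have "?U * (?S * transpose_mat ?V) = ?U * ?S * transpose_mat ?V" by (rule assoc_mult_mat[of _ n r _ r _ m, symmetric]) auto
    finally show ?thesis .
  qed
  have Bx: "B *\<^sub>v w = ?V *\<^sub>v (?S *\<^sub>v (transpose_mat ?U *\<^sub>v w))" if "w \<in> carrier_vec n" for w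
  proof -
    have "B *\<^sub>v w = ?V * ?S * transpose_mat ?U *\<^sub>v w" using svd by (rule arg_cong)
    also have "\<dots> = ?V * ?S *\<^sub>v (transpose_mat ?U *\<^sub>v w)"
      using that VS by (intro assoc_mult_mat_vec[of _ m r _ n]) auto
    also have "\<dots> = ?V *\<^sub>v (?S *\<^sub>v (transpose_mat ?U *\<^sub>v w))"
      by (rule assoc_mult_mat_vec[of _ m r _ r]) auto
    finally show ?thesis .
  qed
  have BTy: "transpose_mat B *\<^sub>v w = ?U *\<^sub>v (?S *\<^sub>v (transpose_mat ?V *\<^sub>v w))" if "w \<in> carrier_vec m" for w
  proof -
    have "transpose_mat B *\<^sub>v w = ?U * ?S *\<^sub>v (transpose_mat ?V *\<^sub>v w)"
      unfolding svdT using that US by (intro assoc_mult_mat_vec[of _ n r _ m]) auto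
    also have "\<dots> = ?U *\<^sub>v (?S *\<^sub>v (transpose_mat ?V *\<^sub>v w))"
      by (rule assoc_mult_mat_vec[of _ n r _ r]) auto
    finally show ?thesis .
  qed
  have Sc: "?S *\<^sub>v q \<in> carrier_vec r" for q by (rule carrier_vecI) (simp add: mat_diag_def)
  have Sq: "(?S *\<^sub>v q) $ i = s i * q $ i" if "i < r" "q \<in> carrier_vec r" for i q
    using that by (simp add: mat_diag_def scalar_prod_def lessThan_atLeast0 if_distrib[of "\<lambda>x. x * _"] cong: if_cong)
  have r_le: "r \<le> min m n" using orthonormal_family_length_le[OF u] orthonormal_family_length_le[OF v] by simp
  \<comment> \<open>On the span of \<open>u\<close> the matrix \<open>B\<close> stretches by at
    least \<open>\<Delta>\<close> and \<open>W\<close> takes away at most \<open>\<epsilon>\<close>;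
    the min-max bound passes this on to the first \<open>r\<close> singular values of
    \<open>B + W\<close>.\<close>
  have z_ge: "\<theta> \<le> z i" if i: "i < r" for i
  proof -
    have "\<theta> \<le> singular_values (B + W) ! i"
    proof (rule singular_value_ge[OF A u _ _ i r_le])
      fix q :: "real vec" assume q: "q \<in> carrier_vec r"
      have Uq: "?U *\<^sub>v q \<in> carrier_vec n" by simp
      have nUq: "vec_norm2 (?U *\<^sub>v q) = vec_norm2 q"
        unfolding vec_norm2_def by (simp only: family_mat_isometry[OF u q q])
      have "B *\<^sub>v (?U *\<^sub>v q) = (B * ?U) *\<^sub>v q" using B q by (intro assoc_mult_mat_vec[symmetric]) auto
      also have "\<dots> = ?V *\<^sub>v (?S *\<^sub>v q)" unfolding BU using q by (intro assoc_mult_mat_vec[of _ m r _ r]) auto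
      finally have "vec_norm2 (B *\<^sub>v (?U *\<^sub>v q)) = vec_norm2 (?S *\<^sub>v q)"
        unfolding vec_norm2_def by (simp only: family_mat_isometry[OF v Sc Sc])
      moreover have "\<Delta> * vec_norm2 q \<le> vec_norm2 (?S *\<^sub>v q)"
      proof -
        have \<Delta>0: "0 \<le> \<Delta>" using \<theta> \<epsilon> by (simp add: \<theta>_def)
        have "(\<Delta> * vec_norm2 q)\<^sup>2 = (\<Sum>i<r. \<Delta>\<^sup>2 * (q $ i)\<^sup>2)"
          by (simp add: power_mult_distrib vec_norm2_power2 scalar_prod_self[OF q] sum_distrib_left)
        also have "\<dots> \<le> (\<Sum>i<r. (s i)\<^sup>2 * (q $ i)\<^sup>2)"
          using \<Delta> \<Delta>0 by (intro sum_mono mult_right_mono power_mono) auto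
        also have "\<dots> = (vec_norm2 (?S *\<^sub>v q))\<^sup>2"
          unfolding vec_norm2_power2 scalar_prod_self[OF Sc]
          by (intro sum.cong refl) (simp only: lessThan_iff Sq[OF _ q] power_mult_distrib)
        finally show ?thesis by (rule power2_le_imp_le) (rule vec_norm2_nonneg)
      qed
      moreover have "vec_norm2 (B *\<^sub>v (?U *\<^sub>v q)) \<le> vec_norm2 ((B + W) *\<^sub>v (?U *\<^sub>v q)) + vec_norm2 (W *\<^sub>v (?U *\<^sub>v q))"
      proof -
        have "B *\<^sub>v (?U *\<^sub>v q) = (B + W) *\<^sub>v (?U *\<^sub>v q) + (-1) \<cdot>\<^sub>v (W *\<^sub>v (?U *\<^sub>v q))"
          unfolding add_mult_distrib_mat_vec[OF B W Uq] using B W Uq by (intro eq_vecI) auto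
        then have "vec_norm2 (B *\<^sub>v (?U *\<^sub>v q)) \<le> vec_norm2 ((B + W) *\<^sub>v (?U *\<^sub>v q)) + vec_norm2 ((-1) \<cdot>\<^sub>v (W *\<^sub>v (?U *\<^sub>v q)))"
          using vec_norm2_triangle[of "(B + W) *\<^sub>v (?U *\<^sub>v q)" m "(-1) \<cdot>\<^sub>v (W *\<^sub>v (?U *\<^sub>v q))"] A W Uq by simp
        then show ?thesis by (simp add: vec_norm2_smult)
      qed
      moreover have "vec_norm2 (W *\<^sub>v (?U *\<^sub>v q)) \<le> \<epsilon> * vec_norm2 q" using norms(2)[OF _ _ Uq] by (simp only: nUq)
      ultimately have "\<theta> * vec_norm2 q \<le> vec_norm2 ((B + W) *\<^sub>v (?U *\<^sub>v q))"
        by (simp add: \<theta>_def left_diff_distrib)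
      then have "(\<theta> * vec_norm2 q)\<^sup>2 \<le> (vec_norm2 ((B + W) *\<^sub>v (?U *\<^sub>v q)))\<^sup>2"
        using \<theta> vec_norm2_nonneg[of q] by (intro power_mono) auto
      then show "\<theta>\<^sup>2 * (q \<bullet> q) \<le> ((B + W) *\<^sub>v (?U *\<^sub>v q)) \<bullet> ((B + W) *\<^sub>v (?U *\<^sub>v q))"
        by (simp only: power_mult_distrib vec_norm2_power2)
    qed (use \<theta> in simp)
    then show ?thesis using z i by simp
  qed
  have "(dist_subspace (y i) (vec_span m (v ` {..<r})))\<^sup>2 \<le> \<epsilon>\<^sup>2 / \<theta>\<^sup>2" if i: "i < r" for i
  proof (rule dist_subspace_le_residual[OF vc _ yc(1)[OF i] _ _ \<theta> z_ge[OF i]])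
    show "z i \<cdot>\<^sub>v y i = ?V *\<^sub>v (?S *\<^sub>v (transpose_mat ?U *\<^sub>v x i)) + W *\<^sub>v x i"
      unfolding Ax[OF i, symmetric] add_mult_distrib_mat_vec[OF B W xc(1)[OF i]] Bx[OF xc(1)[OF i]] ..
    show "vec_norm2 (W *\<^sub>v x i) \<le> \<epsilon>" using norms(2)[OF _ _ xc(1)[OF i]] xc(2)[OF i] by simp
  qed (use Sc W xc(1)[OF i] in auto)
  then have "(\<Sum>i<r. (dist_subspace (y i) (vec_span m (v ` {..<r})))\<^sup>2) \<le> (\<Sum>i<r. \<epsilon>\<^sup>2 / \<theta>\<^sup>2)"
    by (intro sum_mono) simp
  then show "(\<Sum>i<r. (dist_subspace (y i) (vec_span m (v ` {..<r})))\<^sup>2)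
      \<le> real r * ((spectral_norm W)\<^sup>2 / (\<Delta> - spectral_norm W)\<^sup>2)"
    by (simp add: \<theta>_def \<epsilon>_def)
  have "(dist_subspace (x i) (vec_span n (u ` {..<r})))\<^sup>2 \<le> \<epsilon>\<^sup>2 / \<theta>\<^sup>2" if i: "i < r" for i
  proof (rule dist_subspace_le_residual[OF uc _ xc(1)[OF i] _ _ \<theta> z_ge[OF i]])
    have BT: "transpose_mat B \<in> carrier_mat n m" and WT: "transpose_mat W \<in> carrier_mat n m" using B W by auto
    show "z i \<cdot>\<^sub>v x i = ?U *\<^sub>v (?S *\<^sub>v (transpose_mat ?V *\<^sub>v y i)) + transpose_mat W *\<^sub>v y i"
      unfolding Ay[OF i, symmetric] transpose_add[OF B W] add_mult_distrib_mat_vec[OF BT WT yc(1)[OF i]] BTy[OF yc(1)[OF i]] ..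
    show "vec_norm2 (transpose_mat W *\<^sub>v y i) \<le> \<epsilon>" using norms(3)[OF _ _ yc(1)[OF i]] yc(2)[OF i] by simp
  qed (use Sc W yc(1)[OF i] in auto)
  then have "(\<Sum>i<r. (dist_subspace (x i) (vec_span n (u ` {..<r})))\<^sup>2) \<le> (\<Sum>i<r. \<epsilon>\<^sup>2 / \<theta>\<^sup>2)"
    by (intro sum_mono) simp
  then show "(\<Sum>i<r. (dist_subspace (x i) (vec_span n (u ` {..<r})))\<^sup>2)
      \<le> real r * ((spectral_norm W)\<^sup>2 / (\<Delta> - spectral_norm W)\<^sup>2)"
    by (simp add: \<theta>_def \<epsilon>_def)
qed

theorem proposition11:
  fixes P :: "real mat" and a b r :: nat
    and c d K :: real
    and M :: "'w measure"
    and W :: "nat \<Rightarrow> nat \<Rightarrow> 'w \<Rightarrow> real mat"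
  assumes "pattern_matrix a b P" and "P \<noteq> 0\<^sub>m a b" and "vec_space.rank a P = r"
    and "0 < c" and "c < 1" and "0 < d" and "d < 1"
    and "prob_space M" and "0 < K"
    and "\<And>m n. wigner_noise M K m n (W m n)"
  shows "\<exists>C::real. holds_almost_surely M (\<lambda>m n \<omega>.
    \<forall>ms ns s v u z y x.
      block_sizes a m ms \<and> block_sizes b n ns \<and> growth_condition_1 c d ms ns \<and>
      filter (\<lambda>t. 0 < t) (singular_values (blown_up P ms ns)) = map s [0..<r] \<and>
      singular_triples (blown_up P ms ns) r s v u \<and>
      (\<forall>i<r. z i = singular_values (blown_up P ms ns + W m n \<omega>) ! i) \<and>
      singular_triples (blown_up P ms ns + W m n \<omega>) r z y x
      \<longrightarrow>
      (let F = vec_span m (v ` {..<r}); G = vec_span n (u ` {..<r});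
           \<epsilon> = spectral_norm (W m n \<omega>); \<Delta> = Min (s ` {..<r})
       in (\<Sum>i<r. (dist_subspace (y i) F)\<^sup>2) \<le> real r * (\<epsilon>\<^sup>2 / (\<Delta> - \<epsilon>)\<^sup>2) \<and>
          (\<Sum>i<r. (dist_subspace (x i) G)\<^sup>2) \<le> real r * (\<epsilon>\<^sup>2 / (\<Delta> - \<epsilon>)\<^sup>2) \<and>
          real r * (\<epsilon>\<^sup>2 / (\<Delta> - \<epsilon>)\<^sup>2) \<le> C * (real (m + n) / real (m * n))))"
proof -
  obtain \<tau> where \<tau>: "0 < \<tau>" and noise: "AE \<omega> in M. \<exists>k0. \<forall>m n x y. 0 < m \<and> 0 < n \<and> k0 \<le> m + n \<and>
      (\<Sum>i<m. (x i)\<^sup>2) \<le> 1 \<and> (\<Sum>j<n. (y j)\<^sup>2) \<le> 1 \<longrightarrow>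
      (\<Sum>i<m. \<Sum>j<n. x i * W m n \<omega> $$ (i, j) * y j) \<le> \<tau> * sqrt (real (m + n))"
    using wigner_noise_bilinear_bound[OF assms(8,9,10)] by blast
  obtain \<kappa> where \<kappa>: "0 < \<kappa>" and signal: "\<And>ms ns s u v. block_sizes a (sum_list ms) ms \<and> block_sizes b (sum_list ns) ns \<and>
     growth_condition_1 c d ms ns \<and> 0 < sum_list ms \<and> 0 < sum_list ns \<and> 0 < s \<and>
     u \<in> carrier_vec (sum_list ns) \<and> v \<in> carrier_vec (sum_list ms) \<and> scalar_prod u u = 1 \<and> scalar_prod v v = 1 \<and>
     blown_up P ms ns *\<^sub>v u = s \<cdot>\<^sub>v v \<and> transpose_mat (blown_up P ms ns) *\<^sub>v v = s \<cdot>\<^sub>v u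
     \<Longrightarrow> \<kappa> * sqrt (real (sum_list ms) * real (sum_list ns)) \<le> s"
    using blown_up_singular_value_ge[OF assms(4,6), of a b P] by blast
  \<comment> \<open>The factor \<open>4\<close> comes from \<open>\<Delta> - \<epsilon>\<close>
    being at least half of \<open>\<kappa> * sqrt (m * n)\<close>.\<close>
  define C where "C = 4 * real r * \<tau>\<^sup>2 / \<kappa>\<^sup>2"
  \<comment> \<open>Makes the noise at most half of the signal: for \<open>m\<close> and
    \<open>n\<close> at least \<open>N\<close>, \<open>N * (m + n) \<le> 2 * (m * n)\<close>, whence
    \<open>4 * \<tau>\<^sup>2 * (m + n) \<le> \<kappa>\<^sup>2 * (m * n)\<close>. The
    \<open>+ 1\<close> forces \<open>m\<close> and \<open>n\<close> to be positive.\<close>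
  define N where "N = nat \<lceil>8 * \<tau>\<^sup>2 / \<kappa>\<^sup>2\<rceil> + 1"
  have N: "8 * \<tau>\<^sup>2 \<le> \<kappa>\<^sup>2 * real N"
  proof -
    have "8 * \<tau>\<^sup>2 / \<kappa>\<^sup>2 \<le> real N" unfolding N_def by (simp add: of_nat_nat) linarith
    then show ?thesis using \<kappa> by (simp add: field_simps)
  qed
  show ?thesis
    unfolding holds_almost_surely_def
  proof (rule exI[of _ C], use noise AE_space in eventually_elim)
    case (elim \<omega>)
    then obtain k0 where k0: "\<And>m n x y. 0 < m \<and> 0 < n \<and> k0 \<le> m + n \<and>
      (\<Sum>i<m. (x i)\<^sup>2) \<le> 1 \<and> (\<Sum>j<n. (y j)\<^sup>2) \<le> 1 \<Longrightarrow>
      (\<Sum>i<m. \<Sum>j<n. x i * W m n \<omega> $$ (i, j) * y j) \<le> \<tau> * sqrt (real (m + n))" by blast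
    show ?case
    proof (intro exI[of _ "max k0 N"] allI impI, elim conjE)
      fix m n :: nat and ms ns :: "nat list" and s z :: "nat \<Rightarrow> real" and v u y x :: "nat \<Rightarrow> real vec"
      assume large: "max k0 N \<le> m" "max k0 N \<le> n"
        and ms: "block_sizes a m ms" and ns: "block_sizes b n ns" and gc: "growth_condition_1 c d ms ns"
        and s: "filter (\<lambda>t. 0 < t) (singular_values (blown_up P ms ns)) = map s [0..<r]"
        and Bt: "singular_triples (blown_up P ms ns) r s v u"
        and z: "\<forall>i<r. z i = singular_values (blown_up P ms ns + W m n \<omega>) ! i"
        and At: "singular_triples (blown_up P ms ns + W m n \<omega>) r z y x"
      define \<epsilon> where "\<epsilon> = spectral_norm (W m n \<omega>)"
      define \<Delta> where "\<Delta> = Min (s ` {..<r})"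
      have mn: "0 < m" "0 < n" "N \<le> m" "N \<le> n" "k0 \<le> m + n" using large by (auto simp: N_def)
      have sums: "sum_list ms = m" "sum_list ns = n" using ms ns by (auto simp: block_sizes_def)
      have B: "blown_up P ms ns \<in> carrier_mat m n" by (simp add: blown_up_def sums)
      have Wc: "W m n \<omega> \<in> carrier_mat m n"
        using assms(10)[of m n] elim(2) by (simp add: wigner_noise_def)
      have T: "vec_norm2 (W m n \<omega> *\<^sub>v w) \<le> \<tau> * sqrt (real (m + n))"
        if "w \<in> carrier_vec n" "vec_norm2 w \<le> 1" for w
        by (rule vec_norm2_mult_le_if_bilinear[OF Wc _ that]) (use k0 mn in blast)
      have \<epsilon>: "0 \<le> \<epsilon>" "\<epsilon> \<le> \<tau> * sqrt (real (m + n))"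
        unfolding \<epsilon>_def using spectral_norm_le(1,4)[OF Wc T] by auto
      have "(\<Sum>i<r. (dist_subspace (y i) (vec_span m (v ` {..<r})))\<^sup>2) \<le> real r * (\<epsilon>\<^sup>2 / (\<Delta> - \<epsilon>)\<^sup>2) \<and>
          (\<Sum>i<r. (dist_subspace (x i) (vec_span n (u ` {..<r})))\<^sup>2) \<le> real r * (\<epsilon>\<^sup>2 / (\<Delta> - \<epsilon>)\<^sup>2) \<and>
          real r * (\<epsilon>\<^sup>2 / (\<Delta> - \<epsilon>)\<^sup>2) \<le> C * (real (m + n) / real (m * n))"
      proof (cases "r = 0")
        \<comment> \<open>Here \<open>\<Delta>\<close> is the \<open>Min\<close> of an empty set and
          has no usable value, but the sums are empty and the factor \<open>real r\<close> makes the
          right-hand sides \<open>0\<close>.\<close>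
        case True
        then show ?thesis by (simp add: C_def)
      next
        case False
        have \<Delta>_le: "\<Delta> \<le> s i" if "i < r" for i unfolding \<Delta>_def using that by (intro Min_le) auto
        have "\<Delta> \<in> s ` {..<r}" unfolding \<Delta>_def using False by (intro Min_in) auto
        then obtain i where i: "i < r" "\<Delta> = s i" by auto
        have "s i \<in> set (filter (\<lambda>t. 0 < t) (singular_values (blown_up P ms ns)))" unfolding s using i by simp
        then have "0 < s i" by simp
        define D where "D = \<kappa> * sqrt (real m * real n)"
        have D: "0 < D" using \<kappa> mn by (simp add: D_def)
        have "D \<le> \<Delta>"
          using signal[of ms ns "s i" "u i" "v i"] ms ns gc mn \<open>0 < s i\<close> i Bt B
          unfolding D_def sums by (auto simp: singular_triples_def orthonormal_family_def)
        have half: "\<tau> * sqrt (real (m + n)) \<le> D / 2"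
        proof (rule power2_le_imp_le)
          have "real N * real n \<le> real m * real n" "real N * real m \<le> real n * real m"
            using mn by (auto intro!: mult_right_mono)
          then have Nmn: "real N * real (m + n) \<le> 2 * (real m * real n)"
            by (simp add: distrib_left mult.commute)
          have "8 * \<tau>\<^sup>2 * real (m + n) \<le> \<kappa>\<^sup>2 * real N * real (m + n)" using N by (intro mult_right_mono) auto
          also have "\<dots> \<le> \<kappa>\<^sup>2 * (2 * (real m * real n))"
            unfolding mult.assoc using Nmn by (intro mult_left_mono) auto
          finally have "4 * (\<tau>\<^sup>2 * real (m + n)) \<le> \<kappa>\<^sup>2 * (real m * real n)" by (simp add: mult_ac)
          then show "(\<tau> * sqrt (real (m + n)))\<^sup>2 \<le> (D / 2)\<^sup>2"
            by (simp add: D_def power_mult_distrib power_divide)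
        qed (use D in simp)
        have gap: "D / 2 \<le> \<Delta> - \<epsilon>" using \<open>D \<le> \<Delta>\<close> half \<epsilon> by linarith
        have "\<epsilon>\<^sup>2 / (\<Delta> - \<epsilon>)\<^sup>2 \<le> (\<tau> * sqrt (real (m + n)))\<^sup>2 / (D / 2)\<^sup>2"
          using gap D \<epsilon> by (intro frac_le power_mono) auto
        also have "\<dots> = 4 * \<tau>\<^sup>2 / \<kappa>\<^sup>2 * (real (m + n) / real (m * n))"
          by (simp add: D_def power_mult_distrib power_divide)
        finally have "real r * (\<epsilon>\<^sup>2 / (\<Delta> - \<epsilon>)\<^sup>2) \<le> real r * (4 * \<tau>\<^sup>2 / \<kappa>\<^sup>2 * (real (m + n) / real (m * n)))"
          by (intro mult_left_mono) auto
        also have "\<dots> = C * (real (m + n) / real (m * n))" by (simp add: C_def)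
        finally have rate: "real r * (\<epsilon>\<^sup>2 / (\<Delta> - \<epsilon>)\<^sup>2) \<le> C * (real (m + n) / real (m * n))" .
        have "spectral_norm (W m n \<omega>) < \<Delta>" using gap D by (simp add: \<epsilon>_def)
        from singular_subspace_perturbation[OF B Wc s Bt z At T \<Delta>_le this] rate
        show ?thesis by (simp add: \<epsilon>_def)
      qed
      then show "let F = vec_span m (v ` {..<r}); G = vec_span n (u ` {..<r});
           \<epsilon> = spectral_norm (W m n \<omega>); \<Delta> = Min (s ` {..<r})
       in (\<Sum>i<r. (dist_subspace (y i) F)\<^sup>2) \<le> real r * (\<epsilon>\<^sup>2 / (\<Delta> - \<epsilon>)\<^sup>2) \<and>
          (\<Sum>i<r. (dist_subspace (x i) G)\<^sup>2) \<le> real r * (\<epsilon>\<^sup>2 / (\<Delta> - \<epsilon>)\<^sup>2) \<and>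
          real r * (\<epsilon>\<^sup>2 / (\<Delta> - \<epsilon>)\<^sup>2) \<le> C * (real (m + n) / real (m * n))"
        by (simp only: Let_def \<epsilon>_def \<Delta>_def)
    qed
  qed
qed

end
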